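(* Let $\lambda$ be a partition, written in Frobenius coordinates as $\lambda=(a_1,\dots,a_m|b_1,\dots,b_m)$. Then $$s_\lambda(\mathbf p\,\|\,\boldsymbol\alpha;\boldsymbol\beta)=\det\bigl[s_{(a_i|b_j)}(\mathbf p\,\|\,\boldsymbol\alpha;\boldsymbol\beta)\bigr]_{i,j=1}^m.$$
   Context: Frobenius coordinates: $m$ is the number of diagonal boxes of $\lambda$, $a_i=\lambda_i-i$, $b_i=\lambda_i'-i$ ($\lambda'$ the conjugate partition); $(a|b)$ is the hook partition $(a+1,1^b)$. $\boldsymbol\alpha=(\alpha_i)_{i\in\mathbb Z}$, $\boldsymbol\beta=(\beta_i)_{i\in\mathbb Z}$ are sequences in $\mathbb C$. For $k\in\mathbb Z$, $(z;\boldsymbol\alpha)^k=\prod_{i=1}^k(1-z\alpha_i)$ if $k\ge 0$ and $\prod_{i=k+1}^{0}(1-z\alpha_i)^{-1}$ if $k<0$; $(z|\boldsymbol\beta)^k=\prod_{i=1}^k(z-\beta_i)$ if $k\ge0$ and $\prod_{i=k+1}^0(z-\beta_i)^{-1}$ if $k<0$. The Clifford algebra is generated by $\psi_i,\psi_i^*$ ($i\in\mathbb Z$) with $[\psi_i,\psi_j]_+=[\psi_i^*,\psi_j^*]_+=0$, $[\psi_i,\psi_j^*]_+=\delta_{ij}$. The charge $0$ Fock space has basis $|\lambda\rangle=v_{\lambda_1}\wedge v_{\lambda_2-1}\wedge v_{\lambda_3-2}\wedge\cdots$ over partitions $\lambda$; $\psi_j$ acts by $v_j\wedge$, $\psi_j^*$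 by contraction against $v_j$; $\langle\lambda|$ is the dual basis. Normal ordering: $:\!\psi_i\psi_j^*\!:\,=\psi_i\psi_j^*$ if $i>0$, $=-\psi_j^*\psi_i$ if $i\le0$. Deformed currents for $k>0$: $J_k^{(\boldsymbol\alpha;\boldsymbol\beta)}=\sum_{i,j}A_{ij}^k:\!\psi_i\psi_j^*\!:$, the coefficient of $z^{-k}$ in $:\!\psi(z|\boldsymbol\alpha;\boldsymbol\beta)\psi^*(z|\boldsymbol\alpha;\boldsymbol\beta)\!:$ (expanded for $|\beta_a|<|z|<|\alpha_b^{-1}|$, all $a,b$), where $\psi(z|\boldsymbol\alpha;\boldsymbol\beta)=\sum_i z\frac{(z|\boldsymbol\beta)^{i-1}}{(z;\boldsymbol\alpha)^i}\psi_i$, $\psi^*(w|\boldsymbol\alpha;\boldsymbol\beta)=\sum_j(1-\alpha_j\beta_j)\frac{(w;\boldsymbol\alpha)^{j-1}}{(w|\boldsymbol\beta)^j}\psi_j^*$; explicitly $A_{ii}^k=\beta_i^k$, $A_{ij}^k=0$ for $j<i$, and $A_{ij}^k=(1-\alpha_j\beta_j)\sum_{r-s=j-i-k}e_r(-\alpha_{i+1},\dots,-\alpha_{j-1})h_s(\beta_i,\dots,\beta_j)$ for $j>i$, with $e_r,h_s$ elementary and complete homogeneous symmetric polynomials. $H_+(\mathbf p|\boldsymbol\alpha;\boldsymbol\beta)=\sum_{k\ge1}\frac{p_k}{k}J_k^{(\boldsymbol\alpha;\boldsymbol\beta)}$ with $\mathbf p=(p_1,p_2,\dots)$ indeterminates.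 Double factorial Schur functions: $s_\lambda(\mathbf p\,\|\,\boldsymbol\alpha;\boldsymbol\beta)=\langle\varnothing|e^{H_+(\mathbf p|\boldsymbol\alpha;\boldsymbol\beta)}|\lambda\rangle\in\mathbb C[[\mathbf p]]$. *)

theory Defs
  imports
    "HOL-Library.Multiset"
    "HOL-Library.Poly_Mapping"
    "Jordan_Normal_Form.Determinant"
    Complex_Main
begin

section \<open>Formal power series in an arbitrary set of indeterminates\<close>

text \<open>
  A monomial in indeterminates \<open>X\<^sub>i\<close> (\<open>i :: 'x\<close>) is a finite multiset over \<open>'x\<close>; a formal
  power series is an arbitrary coefficient function on monomials.
\<close>

typedef ('x, 'a) pseries = "UNIV :: ('x multiset \<Rightarrow> 'a) set"
  morphisms pseries_coeff Abs_pseries ..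

setup_lifting type_definition_pseries

lemma pseries_eqI: "(\<And>M. pseries_coeff f M = pseries_coeff g M) \<Longrightarrow> f = g"
  by transfer auto

lemma finite_submultisets: "finite {A. A \<subseteq># M}"
proof (rule finite_subset)
  show "{A. A \<subseteq># M} \<subseteq> (\<Union>n\<le>size M. multisets_of_size (set_mset M) n)"
    by (auto simp: multisets_of_size_def size_mset_mono dest: mset_subset_eqD)
qed (auto intro: finite_multisets_of_size)

instantiation pseries :: (type, comm_ring_1) comm_ring_1
begin

lift_definition zero_pseries :: "('a, 'b) pseries" is "\<lambda>_. 0" .
lift_definition one_pseries :: "('a, 'b) pseries" is "\<lambda>M. if M = {#} then 1 else 0" .
lift_definition plus_pseries :: "('a, 'b) pseries \<Rightarrow> ('a, 'b) pseries \<Rightarrow> ('a, 'b) pseries"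
  is "\<lambda>f g M. f M + g M" .
lift_definition minus_pseries :: "('a, 'b) pseries \<Rightarrow> ('a, 'b) pseries \<Rightarrow> ('a, 'b) pseries"
  is "\<lambda>f g M. f M - g M" .
lift_definition uminus_pseries :: "('a, 'b) pseries \<Rightarrow> ('a, 'b) pseries"
  is "\<lambda>f M. - f M" .
lift_definition times_pseries :: "('a, 'b) pseries \<Rightarrow> ('a, 'b) pseries \<Rightarrow> ('a, 'b) pseries"
  is "\<lambda>f g M. \<Sum>A | A \<subseteq># M. f A * g (M - A)" .

instance
proof
  fix f g h :: "('a, 'b) pseries"
  show "f + g + h = f + (g + h)" by transfer (simp add: add.assoc)
  show "f + g = g + f" by transfer (simp add: add.commute)
  show "0 + f = f" by transfer simp
  show "- f + f = 0" by transfer simp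
  show "f - g = f + - g" by transfer simp
  show "(0 :: ('a, 'b) pseries) \<noteq> 1" by transfer (auto simp: fun_eq_iff)
  show "(f + g) * h = f * h + g * h"
    by transfer (simp add: algebra_simps sum.distrib)
  show "1 * f = f"
  proof (transfer, rule ext)
    fix f :: "'a multiset \<Rightarrow> 'b" and M
    have "(\<Sum>A | A \<subseteq># M. (if A = {#} then 1 else 0) * f (M - A))
        = (\<Sum>A | A \<subseteq># M. if A = {#} then f M else 0)"
      by (rule sum.cong) auto
    also have "\<dots> = f M"
      by (simp add: sum.delta finite_submultisets)
    finally show "(\<Sum>A | A \<subseteq># M. (if A = {#} then 1 else 0) * f (M - A)) = f M" .
  qed
  show "f * g = g * f"
  proof (transfer, rule ext)
    fix f g :: "'a multiset \<Rightarrow> 'b" and M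
    have double_diff_mset: "M - (M - A) = A" if "A \<subseteq># M" for A :: "'a multiset"
      using that by (intro multiset_eqI) (simp add: subseteq_mset_def)
    show "(\<Sum>A | A \<subseteq># M. f A * g (M - A)) = (\<Sum>A | A \<subseteq># M. g A * f (M - A))"
      by (rule sum.reindex_bij_witness[of _ "\<lambda>A. M - A" "\<lambda>A. M - A"])
        (auto simp: mult.commute double_diff_mset)
  qed
  show "f * g * h = f * (g * h)"
  proof (transfer, rule ext)
    fix f g h :: "'a multiset \<Rightarrow> 'b" and M
    have join: "A + B \<subseteq># M" if "A \<subseteq># M" "B \<subseteq># M - A" for A B :: "'a multiset"
      using that by (metis subset_mset.le_diff_conv2 add.commute)
    have split: "A - B \<subseteq># M - B" "B \<subseteq># M" "B + (A - B) = A" "M - B - (A - B) = M - A"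
      if "A \<subseteq># M" "B \<subseteq># A" for A B :: "'a multiset"
      using that by (auto simp: subseteq_mset_def intro: diff_le_mono order_trans multiset_eqI)
    have "(\<Sum>A | A \<subseteq># M. (\<Sum>B | B \<subseteq># A. f B * g (A - B)) * h (M - A))
        = (\<Sum>(A, B)\<in>(SIGMA A:{A. A \<subseteq># M}. {B. B \<subseteq># A}). f B * g (A - B) * h (M - A))"
      by (simp add: sum_distrib_right sum.Sigma finite_submultisets)
    also have "\<dots> = (\<Sum>(A, B)\<in>(SIGMA A:{A. A \<subseteq># M}. {B. B \<subseteq># M - A}).
        f A * (g B * h (M - A - B)))"
    proof (rule sum.reindex_bij_witness[of _ "\<lambda>(A, B). (A + B, A)" "\<lambda>(A, B). (B, A - B)"],
        goal_cases)
      case (1 x)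
      then show ?case by (cases x) (auto simp: split(1,3) intro: subset_mset.order_trans)
    next
      case (2 x)
      then show ?case by (cases x) (auto simp: split(1,3) intro: subset_mset.order_trans)
    next
      case (3 x)
      then show ?case by (cases x) simp
    next
      case (4 x)
      then show ?case by (cases x) (simp add: join)
    next
      case (5 x)
      then show ?case by (cases x) (simp add: split mult.assoc)
    qed
    also have "\<dots> = (\<Sum>A | A \<subseteq># M. f A * (\<Sum>B | B \<subseteq># M - A. g B * h (M - A - B)))"
      by (simp add: sum_distrib_left sum.Sigma finite_submultisets)
    finally show "(\<Sum>A | A \<subseteq># M. (\<Sum>B | B \<subseteq># A. f B * g (A - B)) * h (M - A))
        = (\<Sum>A | A \<subseteq># M. f A * (\<Sum>B | B \<subseteq># M - A. g B * h (M - A - B)))" .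
  qed
qed

end


section \<open>Partitions\<close>

text \<open>
  A partition is the list of its nonzero parts; \<open>part l i\<close> is the \<open>i\<close>-th part, counted
  from \<open>i = 1\<close> and extended by zero.
\<close>

definition is_partition :: "nat list \<Rightarrow> bool" where
  "is_partition l \<longleftrightarrow> sorted_wrt (\<ge>) l \<and> 0 \<notin> set l"

definition part :: "nat list \<Rightarrow> nat \<Rightarrow> nat" where
  "part l i = (if 1 \<le> i \<and> i \<le> length l then l ! (i - 1) else 0)"

definition conj_part :: "nat list \<Rightarrow> nat \<Rightarrow> nat" where
  "conj_part l i = card {r. 1 \<le> r \<and> i \<le> part l r}"

definition frob_rank :: "nat list \<Rightarrow> nat" where
  "frob_rank l = card {i. 1 \<le> i \<and> i \<le> part l i}"

text \<open>The truncated subtractions are exact for \<open>1 \<le> i \<le> frob_rank l\<close>.\<close>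

definition frob_a :: "nat list \<Rightarrow> nat \<Rightarrow> nat" where
  "frob_a l i = part l i - i"

definition frob_b :: "nat list \<Rightarrow> nat \<Rightarrow> nat" where
  "frob_b l i = conj_part l i - i"

definition hook :: "nat \<Rightarrow> nat \<Rightarrow> nat list" where
  "hook a b = (a + 1) # replicate b 1"


section \<open>The fermionic Fock space\<close>

text \<open>
  A semi-infinite wedge \<open>v\<^bsub>s\<^sub>1\<^esub> \<and> v\<^bsub>s\<^sub>2\<^esub> \<and> \<dots>\<close> with \<open>s\<^sub>1 > s\<^sub>2 > \<dots>\<close> is given by
  its set of indices. The type comprises all charges, since \<open>\<psi>\<^sub>i\<close> and \<open>\<psi>\<^sub>i\<^sup>*\<close> change the charge.
\<close>

typedef maya = "{S :: int set. finite (S \<inter> {0<..}) \<and> finite ({..0} - S)}"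
  morphisms occupied Abs_maya
proof
  have "{..0} \<inter> {0<..} = ({} :: int set)" by auto
  then show "{..0} \<in> {S :: int set. finite (S \<inter> {0<..}) \<and> finite ({..0} - S)}" by simp
qed

setup_lifting type_definition_maya

type_synonym fock = "maya \<Rightarrow>\<^sub>0 complex"

lift_definition maya_insert :: "int \<Rightarrow> maya \<Rightarrow> maya" is "insert"
proof -
  fix j :: int and S :: "int set"
  assume "finite (S \<inter> {0<..}) \<and> finite ({..0} - S)"
  then show "finite (insert j S \<inter> {0<..}) \<and> finite ({..0} - insert j S)"
    by (auto intro: finite_subset[of _ "insert j (S \<inter> {0<..})"] finite_subset[of _ "{..0} - S"])
qed

lift_definition maya_remove :: "int \<Rightarrow> maya \<Rightarrow> maya" is "\<lambda>j S. S - {j}"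
proof -
  fix j :: int and S :: "int set"
  assume "finite (S \<inter> {0<..}) \<and> finite ({..0} - S)"
  then show "finite ((S - {j}) \<inter> {0<..}) \<and> finite ({..0} - (S - {j}))"
    by (auto intro: finite_subset[of _ "S \<inter> {0<..}"] finite_subset[of _ "insert j ({..0} - S)"])
qed

text \<open>The wedge \<open>v\<^bsub>\<lambda>\<^sub>1\<^esub> \<and> v\<^bsub>\<lambda>\<^sub>2 - 1\<^esub> \<and> v\<^bsub>\<lambda>\<^sub>3 - 2\<^esub> \<and> \<dots>\<close>.\<close>

lift_definition maya_of :: "nat list \<Rightarrow> maya"
  is "\<lambda>l. {int (part l i) - int i + 1 | i. 1 \<le> i}"
proof -
  fix l :: "nat list"
  let ?S = "{int (part l i) - int i + 1 | i. 1 \<le> i}"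
  have "?S \<inter> {0<..} \<subseteq> (\<lambda>i. int (part l i) - int i + 1) ` {1..length l}"
    by (auto simp: part_def split: if_splits)
  then have 1: "finite (?S \<inter> {0<..})"
    by (rule finite_subset) auto
  have "x \<in> ?S" if "x \<le> - int (length l)" for x
    by (rule CollectI, rule exI[of _ "nat (1 - x)"]) (use that in \<open>auto simp: part_def\<close>)
  then have "{..0} - ?S \<subseteq> {- int (length l)..0}"
    by force
  then have 2: "finite ({..0} - ?S)"
    by (rule finite_subset) auto
  from 1 2 show "finite (?S \<inter> {0<..}) \<and> finite ({..0} - ?S)" ..
qed

definition ket :: "nat list \<Rightarrow> fock" where
  "ket l = Poly_Mapping.single (maya_of l) 1"

definition bra :: "nat list \<Rightarrow> fock \<Rightarrow> complex" where
  "bra l v = Poly_Mapping.lookup v (maya_of l)"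

definition fscale :: "complex \<Rightarrow> fock \<Rightarrow> fock" where
  "fscale c v = Poly_Mapping.map ((*) c) v"

definition lin_ext :: "(maya \<Rightarrow> fock) \<Rightarrow> fock \<Rightarrow> fock" where
  "lin_ext F v = (\<Sum>S\<in>Poly_Mapping.keys v. fscale (Poly_Mapping.lookup v S) (F S))"

text \<open>
  Moving \<open>v\<^sub>j\<close> past the factors \<open>v\<^sub>s\<close> with \<open>s > j\<close> produces one sign each; there are finitely
  many of these.
\<close>

definition wedge_sign :: "int \<Rightarrow> maya \<Rightarrow> complex" where
  "wedge_sign j S = (-1) ^ card {s \<in> occupied S. s > j}"

definition psi :: "int \<Rightarrow> fock \<Rightarrow> fock" where
  "psi j = lin_ext (\<lambda>S. if j \<in> occupied S then 0
     else Poly_Mapping.single (maya_insert j S) (wedge_sign j S))"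

definition psi_star :: "int \<Rightarrow> fock \<Rightarrow> fock" where
  "psi_star j = lin_ext (\<lambda>S. if j \<in> occupied S
     then Poly_Mapping.single (maya_remove j S) (wedge_sign j S) else 0)"

definition normal_ordered :: "int \<Rightarrow> int \<Rightarrow> fock \<Rightarrow> fock" where
  "normal_ordered i j v = (if i > 0 then psi i (psi_star j v) else - psi_star j (psi i v))"


section \<open>Deformed currents and double factorial Schur functions\<close>

definition elem_sym :: "nat \<Rightarrow> int set \<Rightarrow> (int \<Rightarrow> complex) \<Rightarrow> complex" where
  "elem_sym r I x = (\<Sum>Y | Y \<subseteq> I \<and> card Y = r. \<Prod>i\<in>Y. x i)"

definition complete_sym :: "nat \<Rightarrow> int set \<Rightarrow> (int \<Rightarrow> complex) \<Rightarrow> complex" where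
  "complete_sym s I x = (\<Sum>Y\<in>multisets_of_size I s. \<Prod>i\<in>#Y. x i)"

text \<open>
  This is the coefficient of \<open>z\<^sup>-\<^sup>k\<close> (\<open>k > 0\<close>) in
  \<open>(1 - \<alpha>\<^sub>j\<beta>\<^sub>j) z (z|\<beta>)\<^bsup>i-1\<^esup> (z;\<alpha>)\<^bsup>j-1\<^esup> / ((z;\<alpha>)\<^bsup>i\<^esup> (z|\<beta>)\<^bsup>j\<^esup>)\<close>, where
  \<open>1 / (1 - z \<alpha>\<^sub>a)\<close> is expanded at \<open>z = 0\<close> and \<open>1 / (z - \<beta>\<^sub>a)\<close> at \<open>z = \<infinity>\<close>. For \<open>j > i\<close> the factors left
  over are \<open>\<Prod>\<^bsub>i<a<j\<^esub> (1 - z \<alpha>\<^sub>a)\<close>, whose coefficients are the \<open>e\<^sub>r\<close>, and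
  \<open>\<Prod>\<^bsub>i\<le>a\<le>j\<^esub> 1 / (z - \<beta>\<^sub>a)\<close>, whose coefficients are the \<open>h\<^sub>s\<close>.
  The sum runs over all \<open>r, s \<ge> 0\<close> with \<open>r - s = j - i - k\<close>; the bound on \<open>r\<close> only
  discards terms with \<open>e\<^sub>r = 0\<close> (there are \<open>j - i - 1\<close> variables) and makes the index set finite.
\<close>

definition current_coeff ::
    "(int \<Rightarrow> complex) \<Rightarrow> (int \<Rightarrow> complex) \<Rightarrow> nat \<Rightarrow> int \<Rightarrow> int \<Rightarrow> complex" where
  "current_coeff \<alpha> \<beta> k i j =
     (if j < i then 0
      else if j = i then \<beta> i ^ k
      else (1 - \<alpha> j * \<beta> j) *
        (\<Sum>(r, s) | r \<le> nat (j - i - 1) \<and> int r - int s = j - i - int k.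
           elem_sym r {i+1..j-1} (\<lambda>a. - \<alpha> a) * complete_sym s {i..j} \<beta>))"

text \<open>
  \<open>Sum_any\<close> is the sum over the (finite) support; see \<open>finite_current_support\<close> below.
\<close>

definition current :: "(int \<Rightarrow> complex) \<Rightarrow> (int \<Rightarrow> complex) \<Rightarrow> nat \<Rightarrow> fock \<Rightarrow> fock" where
  "current \<alpha> \<beta> k v =
     Sum_any (\<lambda>(i, j). fscale (current_coeff \<alpha> \<beta> k i j) (normal_ordered i j v))"

text \<open>
  Operators with coefficients in \<open>\<complex>[[p\<^sub>1, p\<^sub>2, \<dots>]]\<close> act on Fock-space-valued power series, i.e. on
  functions from monomials to \<open>fock\<close>. The indeterminate \<open>p\<^bsub>i+1\<^esub>\<close> has index \<open>i :: nat\<close>, and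
  multiplication by it sends \<open>f\<close> to \<open>\<lambda>M. if i \<in># M then f (M - {#i#}) else 0\<close>. So \<open>H_plus\<close> is
  \<open>\<Sum>k\<ge>1. p\<^sub>k / k * J\<^sub>k\<close> with \<open>k = i + 1\<close>.
\<close>

definition H_plus :: "(int \<Rightarrow> complex) \<Rightarrow> (int \<Rightarrow> complex) \<Rightarrow>
    (nat multiset \<Rightarrow> fock) \<Rightarrow> (nat multiset \<Rightarrow> fock)" where
  "H_plus \<alpha> \<beta> f M =
     (\<Sum>i\<in>set_mset M. fscale (1 / of_nat (i + 1)) (current \<alpha> \<beta> (i + 1) (f (M - {#i#}))))"

definition const_series :: "fock \<Rightarrow> nat multiset \<Rightarrow> fock" where
  "const_series v M = (if M = {#} then v else 0)"

text \<open>
  Each coefficient of \<open>exp H\<^sub>+\<close> is a finite sum because \<open>H\<^sub>+\<close> raises the number of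
  indeterminates in a monomial; see \<open>finite_exp_support\<close> below.
\<close>

definition exp_H_plus :: "(int \<Rightarrow> complex) \<Rightarrow> (int \<Rightarrow> complex) \<Rightarrow>
    (nat multiset \<Rightarrow> fock) \<Rightarrow> (nat multiset \<Rightarrow> fock)" where
  "exp_H_plus \<alpha> \<beta> f M = Sum_any (\<lambda>n. fscale (1 / fact n) ((H_plus \<alpha> \<beta> ^^ n) f M))"

definition double_schur ::
    "(int \<Rightarrow> complex) \<Rightarrow> (int \<Rightarrow> complex) \<Rightarrow> nat list \<Rightarrow> (nat, complex) pseries" where
  "double_schur \<alpha> \<beta> l = Abs_pseries (\<lambda>M. bra [] (exp_H_plus \<alpha> \<beta> (const_series (ket l)) M))"


section \<open>Well-definedness\<close>

lemma lookup_fscale [simp]: "Poly_Mapping.lookup (fscale c v) S = c * Poly_Mapping.lookup v S"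
  by (simp add: fscale_def Poly_Mapping.map.rep_eq when_def)

lemma fscale_0_right [simp]: "fscale c 0 = 0"
  and fscale_0_left [simp]: "fscale 0 v = 0"
  and fscale_single [simp]: "fscale c (Poly_Mapping.single S x) = Poly_Mapping.single S (c * x)"
  and fscale_1 [simp]: "fscale 1 v = v"
  and fscale_add_right: "fscale c (v + w) = fscale c v + fscale c w"
  and fscale_add_left: "fscale (c + d) v = fscale c v + fscale d v"
  and fscale_fscale: "fscale c (fscale d v) = fscale (c * d) v"
  and fscale_minus_right: "fscale c (- v) = - fscale c v"
  by (rule poly_mapping_eqI; simp add: algebra_simps lookup_add lookup_single when_def)+

lemma fscale_sum: "fscale c (\<Sum>x\<in>A. f x) = (\<Sum>x\<in>A. fscale c (f x))"
  by (induction A rule: infinite_finite_induct) (auto simp: fscale_add_right)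

lemma lin_ext_superset:
  assumes "finite K" "Poly_Mapping.keys v \<subseteq> K"
  shows "lin_ext F v = (\<Sum>S\<in>K. fscale (Poly_Mapping.lookup v S) (F S))"
  unfolding lin_ext_def using assms
  by (intro sum.mono_neutral_left) (auto simp: in_keys_iff)

lemma lin_ext_0 [simp]: "lin_ext F 0 = 0"
  by (simp add: lin_ext_def)

lemma lin_ext_single [simp]: "lin_ext F (Poly_Mapping.single S c) = fscale c (F S)"
  by (subst lin_ext_superset[of "{S}"]) auto

lemma lin_ext_add: "lin_ext F (v + w) = lin_ext F v + lin_ext F w"
proof -
  let ?K = "Poly_Mapping.keys v \<union> Poly_Mapping.keys w"
  have "Poly_Mapping.keys (v + w) \<subseteq> ?K"
    by (rule Poly_Mapping.keys_add)
  then show ?thesis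
    by (simp add: lin_ext_superset[of ?K] lookup_add fscale_add_left sum.distrib)
qed

lemma lin_ext_fscale: "lin_ext F (fscale c v) = fscale c (lin_ext F v)"
proof -
  have "Poly_Mapping.keys (fscale c v) \<subseteq> Poly_Mapping.keys v"
    by (auto simp: in_keys_iff)
  then show ?thesis
    by (simp add: lin_ext_superset[of "Poly_Mapping.keys v"] fscale_sum fscale_fscale)
qed

lemma psi_add: "psi i (v + w) = psi i v + psi i w"
  and psi_fscale: "psi i (fscale c v) = fscale c (psi i v)"
  and psi_star_add: "psi_star i (v + w) = psi_star i v + psi_star i w"
  and psi_star_fscale: "psi_star i (fscale c v) = fscale c (psi_star i v)"
  by (simp_all add: psi_def psi_star_def lin_ext_add lin_ext_fscale)

lemma psi_0 [simp]: "psi i 0 = 0" and psi_star_0 [simp]: "psi_star i 0 = 0"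
  by (simp_all add: psi_def psi_star_def)

lemma psi_single: "psi i (Poly_Mapping.single S c) =
    (if i \<in> occupied S then 0 else Poly_Mapping.single (maya_insert i S) (c * wedge_sign i S))"
  and psi_star_single: "psi_star i (Poly_Mapping.single S c) =
    (if i \<in> occupied S then Poly_Mapping.single (maya_remove i S) (c * wedge_sign i S) else 0)"
  by (simp_all add: psi_def psi_star_def)

lemma normal_ordered_add: "normal_ordered i j (v + w) = normal_ordered i j v + normal_ordered i j w"
  and normal_ordered_0 [simp]: "normal_ordered i j 0 = 0"
  by (simp_all add: normal_ordered_def psi_add psi_star_add)

lemma fock_induct [case_names zero add]:
  assumes "P 0" "\<And>S c v. P v \<Longrightarrow> P (Poly_Mapping.single S c + v)"
  shows "P (v :: fock)"
proof -
  have "P v" if "finite K" "Poly_Mapping.keys v = K" for K and v :: fock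
    using that
  proof (induction K arbitrary: v rule: finite_induct)
    case empty
    then show ?case using assms(1) by simp
  next
    case (insert S K)
    let ?w = "Poly_Mapping.update S 0 v"
    have "Poly_Mapping.keys ?w = K"
      using insert.hyps insert.prems by (auto simp: keys_update)
    then have "P ?w" by (rule insert.IH)
    moreover have "v = Poly_Mapping.single S (Poly_Mapping.lookup v S) + ?w"
      by (rule poly_mapping_eqI) (auto simp: lookup_add lookup_single lookup_update when_def)
    ultimately show ?case using assms(2) by metis
  qed
  from this[OF finite_keys refl] show ?thesis .
qed

lemma finite_current_support:
  "finite {x. (case x of (i, j) \<Rightarrow>
     fscale (current_coeff \<alpha> \<beta> k i j) (normal_ordered i j v)) \<noteq> 0}"
proof (induction v rule: fock_induct)
  case zero
  then show ?case by (simp add: case_prod_unfold)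
next
  case (add S c v)
  define T where "T = occupied S"
  have "finite (T \<inter> {0<..})" "finite ({..0} - T)"
    using occupied[of S] by (auto simp: T_def)
  then have "bdd_above (T \<inter> {0<..})" "bdd_below ({..0} - T)"
    by auto
  then obtain N L where NL: "\<forall>s\<in>T \<inter> {0<..}. s \<le> N" "\<forall>s\<in>{..0} - T. L \<le> s"
    unfolding bdd_above_def bdd_below_def by blast
  have N: "s \<le> N" if "s \<in> T" "0 < s" for s
    using NL that by auto
  have L: "L \<le> s" if "s \<notin> T" "s \<le> 0" for s
    using NL that by auto
  have sub: "{x. (case x of (i, j) \<Rightarrow> fscale (current_coeff \<alpha> \<beta> k i j)
      (normal_ordered i j (Poly_Mapping.single S c))) \<noteq> 0} \<subseteq> {min L 0..max N 0} \<times> {min L 0..max N 0}"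
  proof clarify
    fix i j
    assume nz: "fscale (current_coeff \<alpha> \<beta> k i j) (normal_ordered i j (Poly_Mapping.single S c)) \<noteq> 0"
    then have ij: "i \<le> j"
      by (rule contrapos_np) (simp add: current_coeff_def)
    have no: "normal_ordered i j (Poly_Mapping.single S c) \<noteq> 0"
      using nz by auto
    have "min L 0 \<le> i \<and> j \<le> max N 0"
    proof (cases "i > 0")
      case True
      with no have "j \<in> T"
        by (auto simp: normal_ordered_def psi_star_single T_def split: if_splits)
      with True ij N[of j] show ?thesis by auto
    next
      case False
      with no have "i \<notin> T" "j \<in> insert i T"
        by (auto simp: normal_ordered_def psi_star_single psi_single T_def maya_insert.rep_eq
            split: if_splits)
      with False ij N[of j] L[of i] show ?thesis
        by (cases "0 < j") auto
    qed
    with ij show "i \<in> {min L 0..max N 0} \<and> j \<in> {min L 0..max N 0}" by auto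
  qed
  have "finite ({x. (case x of (i, j) \<Rightarrow> fscale (current_coeff \<alpha> \<beta> k i j)
      (normal_ordered i j (Poly_Mapping.single S c))) \<noteq> 0} \<union>
      {x. (case x of (i, j) \<Rightarrow> fscale (current_coeff \<alpha> \<beta> k i j) (normal_ordered i j v)) \<noteq> 0})"
    using finite_subset[OF sub] add by auto
  then show ?case
    by (rule rev_finite_subset) (auto simp: normal_ordered_add fscale_add_right)
qed

lemma current_0 [simp]: "current \<alpha> \<beta> k 0 = 0"
  by (simp add: current_def case_prod_unfold)

lemma H_plus_pow_eq_0:
  assumes "size M < n"
  shows "(H_plus \<alpha> \<beta> ^^ n) f M = 0"
  using assms
proof (induction n arbitrary: M)
  case (Suc n)
  have "(H_plus \<alpha> \<beta> ^^ n) f (M - {#i#}) = 0" if "i \<in># M" for i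
    using that Suc.prems by (intro Suc.IH) (auto simp: size_Diff_singleton dest: multi_member_split)
  then show ?case
    by (simp add: H_plus_def[of _ _ "(H_plus \<alpha> \<beta> ^^ n) f"])
qed auto

lemma finite_exp_support: "finite {n. fscale (1 / fact n) ((H_plus \<alpha> \<beta> ^^ n) f M) \<noteq> 0}"
proof (rule finite_subset)
  show "{n. fscale (1 / fact n) ((H_plus \<alpha> \<beta> ^^ n) f M) \<noteq> 0} \<subseteq> {..size M}"
  proof
    fix n
    assume "n \<in> {n. fscale (1 / fact n) ((H_plus \<alpha> \<beta> ^^ n) f M) \<noteq> 0}"
    then have "(H_plus \<alpha> \<beta> ^^ n) f M \<noteq> 0" by auto
    then have "\<not> size M < n" using H_plus_pow_eq_0 by blast
    then show "n \<in> {..size M}" by simp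
  qed
qed simp

lemma finite_above: "finite {s \<in> occupied S. s > j}"
  by (rule finite_subset[of _ "(occupied S \<inter> {0<..}) \<union> {j..0}"]) (use occupied[of S] in auto)

lemma maya_eqI: "occupied S = occupied T \<Longrightarrow> S = T"
  by (simp add: occupied_inject)

lemma wedge_sign_insert:
  assumes "i \<notin> occupied S"
  shows "wedge_sign j (maya_insert i S) = (if j < i then - 1 else 1) * wedge_sign j S"
proof -
  have "{s \<in> occupied (maya_insert i S). s > j} =
      (if j < i then insert i {s \<in> occupied S. s > j} else {s \<in> occupied S. s > j})"
    by (auto simp: maya_insert.rep_eq)
  then show ?thesis
    using assms by (simp add: wedge_sign_def finite_above)
qed

lemma wedge_sign_remove:
  assumes "i \<in> occupied S"
  shows "wedge_sign j (maya_remove i S) = (if j < i then - 1 else 1) * wedge_sign j S"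
proof -
  have "S = maya_insert i (maya_remove i S)" "i \<notin> occupied (maya_remove i S)"
    using assms by (auto intro!: maya_eqI simp: maya_insert.rep_eq maya_remove.rep_eq)
  from wedge_sign_insert[OF this(2), of j] this(1) show ?thesis
    by auto
qed

lemma wedge_sign_square: "wedge_sign j S * wedge_sign j S = 1"
  by (simp add: wedge_sign_def flip: power_add)

lemmas car_simps = psi_single psi_star_single maya_insert.rep_eq maya_remove.rep_eq
  wedge_sign_insert wedge_sign_remove

lemma psi_psi: "psi i (psi j v) + psi j (psi i v) = 0"
proof (induction v rule: fock_induct)
  case (add S c v)
  have "maya_insert i (maya_insert j S) = maya_insert j (maya_insert i S)"
    by (auto intro!: maya_eqI simp: maya_insert.rep_eq)
  then have "psi i (psi j (Poly_Mapping.single S c)) + psi j (psi i (Poly_Mapping.single S c)) = 0"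
    by (auto simp: car_simps simp flip: single_add single_uminus)
  moreover have "psi i (psi j (Poly_Mapping.single S c + v)) + psi j (psi i (Poly_Mapping.single S c + v)) =
      (psi i (psi j (Poly_Mapping.single S c)) + psi j (psi i (Poly_Mapping.single S c))) +
      (psi i (psi j v) + psi j (psi i v))"
    by (simp add: psi_add psi_star_add algebra_simps)
  ultimately show ?case using add by simp
qed simp

lemma psi_star_psi_star: "psi_star i (psi_star j v) + psi_star j (psi_star i v) = 0"
proof (induction v rule: fock_induct)
  case (add S c v)
  have "maya_remove i (maya_remove j S) = maya_remove j (maya_remove i S)"
    by (auto intro!: maya_eqI simp: maya_remove.rep_eq)
  then have "psi_star i (psi_star j (Poly_Mapping.single S c)) +
      psi_star j (psi_star i (Poly_Mapping.single S c)) = 0"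
    by (auto simp: car_simps simp flip: single_add single_uminus)
  moreover have "psi_star i (psi_star j (Poly_Mapping.single S c + v)) + psi_star j (psi_star i (Poly_Mapping.single S c + v)) =
      (psi_star i (psi_star j (Poly_Mapping.single S c)) + psi_star j (psi_star i (Poly_Mapping.single S c))) +
      (psi_star i (psi_star j v) + psi_star j (psi_star i v))"
    by (simp add: psi_add psi_star_add algebra_simps)
  ultimately show ?case using add by simp
qed simp

lemma psi_psi_star: "psi i (psi_star j v) + psi_star j (psi i v) = (if i = j then v else 0)"
proof (induction v rule: fock_induct)
  case (add S c v)
  have "maya_insert i (maya_remove j S) = maya_remove j (maya_insert i S)" if "i \<noteq> j"
    using that by (auto intro!: maya_eqI simp: maya_insert.rep_eq maya_remove.rep_eq)
  moreover have "maya_insert i (maya_remove i S) = S" if "i \<in> occupied S"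
    using that by (auto intro!: maya_eqI simp: maya_insert.rep_eq maya_remove.rep_eq)
  moreover have "maya_remove i (maya_insert i S) = S" if "i \<notin> occupied S"
    using that by (auto intro!: maya_eqI simp: maya_insert.rep_eq maya_remove.rep_eq)
  ultimately have "psi i (psi_star j (Poly_Mapping.single S c)) +
      psi_star j (psi i (Poly_Mapping.single S c)) = (if i = j then Poly_Mapping.single S c else 0)"
    by (auto simp: car_simps mult.assoc wedge_sign_square simp flip: single_add)
  moreover have "psi i (psi_star j (Poly_Mapping.single S c + v)) + psi_star j (psi i (Poly_Mapping.single S c + v)) =
      (psi i (psi_star j (Poly_Mapping.single S c)) + psi_star j (psi i (Poly_Mapping.single S c))) +
      (psi i (psi_star j v) + psi_star j (psi i v))"
    by (simp add: psi_add psi_star_add algebra_simps)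
  ultimately show ?case using add by simp
qed simp

end

theory Submission
  imports Defs
begin

text \<open>
  The theorem is Wick's theorem for the functional \<open>\<langle>\<emptyset>| e\<^bsup>H\<^sub>+\<^esup>\<close>. In Frobenius coordinates,
  \<open>|\<lambda>\<rangle>\<close> is up to the sign \<open>\<Prod>\<^sub>j (-1)\<^bsup>b\<^sub>j\<^esup>\<close> the state
  \<open>\<psi>\<^bsub>a\<^sub>1+1\<^esub> \<dots> \<psi>\<^bsub>a\<^sub>m+1\<^esub> \<psi>\<^sup>*\<^bsub>-b\<^sub>m\<^esub> \<dots> \<psi>\<^sup>*\<^bsub>-b\<^sub>1\<^esub> |\<emptyset>\<rangle>\<close>: the particles in positive positions are the
  \<open>a\<^sub>i + 1\<close> and the holes in nonpositive positions are the \<open>-b\<^sub>j\<close>. A hook is the case \<open>m = 1\<close>. So the claim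
  says that the vacuum expectation of such a product is the determinant of the expectations of
  the pairs, once the signs are pulled out of the columns of the determinant.

  The usual proof conjugates the fermions by \<open>e\<^bsup>H\<^sub>+\<^esup>\<close>, which turns each \<open>\<psi>\<^sub>s\<close> into an infinite sum.
  Only finite sums occur when the exponential is replaced by the differential equation
  that it satisfies. \<open>H\<^sub>+\<close> is homogeneous of degree \<open>1\<close> in the indeterminates, so the derivation \<open>E\<close>
  that multiplies the homogeneous component of degree \<open>n\<close> by \<open>n\<close> satisfies
  \<open>E \<langle>\<emptyset>| e\<^bsup>H\<^sub>+\<^esup> |v\<rangle> = \<langle>\<emptyset>| e\<^bsup>H\<^sub>+\<^esup> H\<^sub>+ |v\<rangle>\<close>. Moreover \<open>H\<^sub>+\<close> is quadratic in the fermions, it kills the vacuum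
  because its coefficient matrix \<open>h\<close> is upper triangular, and its commutators with \<open>\<psi>\<^sub>s\<close> and
  \<open>\<psi>\<^sup>*\<^sub>t\<close> are linear. So \<open>H\<^sub>+\<close> applied to a product with positive \<open>s\<^sub>p\<close> and nonpositive \<open>t\<^sub>q\<close> gives
  (\<open>current_slater\<close>) the products in which one \<open>s\<^sub>p\<close> is
  lowered to some \<open>u \<ge> 1\<close>, minus those in which one \<open>t\<^sub>q\<close> is raised to some \<open>u \<le> 0\<close>, plus those in which
  \<open>\<psi>\<close> at \<open>s\<^sub>p\<close> has moved to \<open>t\<^sub>q\<close> and the two have cancelled.

  The determinant of pair expectations satisfies the same equation (\<open>euler_pair_det\<close>): by
  Jacobi's formula \<open>E (det B) = \<Sum>\<^sub>i\<^sub>j E(B\<^sub>i\<^sub>j) C\<^sub>i\<^sub>j\<close> with the cofactors \<open>C\<^sub>i\<^sub>j\<close>, the three kinds of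
  terms in \<open>E(B\<^sub>i\<^sub>j)\<close> become determinants with a changed row, determinants with a changed column, and minors.
  Since the entries of \<open>h\<close> have degree \<open>1\<close>, the equation determines each homogeneous
  component from the previous one, so the two sides agree (\<open>wick_unique\<close>) as soon as their constant terms do.
\<close>

section \<open>The degree derivation on power series, and determinants\<close>

lift_definition euler :: "('x, 'a::comm_ring_1) pseries \<Rightarrow> ('x, 'a) pseries"
  is "\<lambda>f M. of_nat (size M) * f M" .

text \<open>
  The series \<open>\<Sum>\<^sub>x c\<^sub>x X\<^sub>x\<close>, which may have infinitely many terms. The sum in the body has at most one
  nonzero summand, and it avoids choosing the element of a singleton multiset.
\<close>

lift_definition linear_form :: "('x \<Rightarrow> 'a::comm_ring_1) \<Rightarrow> ('x, 'a) pseries"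
  is "\<lambda>c M. \<Sum>x\<in>set_mset M. if M = {#x#} then c x else 0" .

lemma pseries_coeff_sum: "pseries_coeff (sum f A) M = (\<Sum>x\<in>A. pseries_coeff (f x) M)"
  by (induction A rule: infinite_finite_induct)
     (simp_all add: zero_pseries.rep_eq plus_pseries.rep_eq)

lemma pseries_coeff_linear_form_times:
  "pseries_coeff (linear_form c * f) M = (\<Sum>x\<in>set_mset M. c x * pseries_coeff f (M - {#x#}))"
proof -
  have "pseries_coeff (linear_form c * f) M =
      (\<Sum>A | A \<subseteq># M. pseries_coeff (linear_form c) A * pseries_coeff f (M - A))"
    by (simp add: times_pseries.rep_eq)
  also have "\<dots> = (\<Sum>A\<in>(\<lambda>x. {#x#}) ` set_mset M. pseries_coeff (linear_form c) A * pseries_coeff f (M - A))"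
  proof (rule sum.mono_neutral_right)
    show "\<forall>A\<in>{A. A \<subseteq># M} - (\<lambda>x. {#x#}) ` set_mset M.
        pseries_coeff (linear_form c) A * pseries_coeff f (M - A) = 0"
    proof
      fix A
      assume A: "A \<in> {A. A \<subseteq># M} - (\<lambda>x. {#x#}) ` set_mset M"
      then have "A \<noteq> {#x#}" if "x \<in># A" for x
        using that mset_subset_eqD[of A M x] by auto
      then show "pseries_coeff (linear_form c) A * pseries_coeff f (M - A) = 0"
        by (simp add: linear_form.rep_eq)
    qed
  qed (auto simp: finite_submultisets)
  also have "\<dots> = (\<Sum>x\<in>set_mset M. c x * pseries_coeff f (M - {#x#}))"
    by (subst sum.reindex) (auto simp: inj_on_def linear_form.rep_eq)
  finally show ?thesis .
qed

lemma euler_sum: "euler (sum f A) = (\<Sum>x\<in>A. euler (f x))"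
  by (rule pseries_eqI) (simp add: euler.rep_eq pseries_coeff_sum sum_distrib_left)

lemma euler_minus: "euler (- f) = - euler f"
  by (rule pseries_eqI) (simp add: euler.rep_eq uminus_pseries.rep_eq)

lemma euler_one: "euler 1 = 0"
  by (rule pseries_eqI) (simp add: euler.rep_eq zero_pseries.rep_eq one_pseries.rep_eq)

lemma euler_mult: "euler (f * g) = euler f * g + f * euler g"
proof (rule pseries_eqI)
  fix M :: "'a multiset"
  have "of_nat (size M) * (x * y) = of_nat (size A) * x * y + x * (of_nat (size (M - A)) * y)"
    if "A \<subseteq># M" for A and x y :: 'b
  proof -
    have "size M = size A + size (M - A)"
      using that by (simp add: size_Diff_submset size_mset_mono)
    then show ?thesis
      by (simp add: algebra_simps)
  qed
  then show "pseries_coeff (euler (f * g)) M = pseries_coeff (euler f * g + f * euler g) M"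
    by (simp add: euler.rep_eq times_pseries.rep_eq plus_pseries.rep_eq sum_distrib_left
        flip: sum.distrib)
qed

lemma euler_sign_mult: "euler (signof p * f) = signof p * euler f"
  by (simp add: sign_def euler_minus)

text \<open>
  The product rule in the form that fits the Leibniz expansion of a determinant: one summand for
  each factor to which the derivation is applied.
\<close>

lemma euler_prod:
  assumes "finite A"
  shows "euler (\<Prod>x\<in>A. f x) = (\<Sum>y\<in>A. \<Prod>x\<in>A. if x = y then euler (f x) else f x)"
  using assms
proof (induction A rule: finite_induct)
  case empty
  then show ?case by (simp add: euler_one)
next
  case (insert a A)
  have "(\<Prod>x\<in>A. if x = a then euler (f x) else f x) = prod f A"
    using insert.hyps by (intro prod.cong) auto
  moreover have "(\<Sum>y\<in>A. \<Prod>x\<in>insert a A. if x = y then euler (f x) else f x) =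
      f a * (\<Sum>y\<in>A. \<Prod>x\<in>A. if x = y then euler (f x) else f x)"
    using insert.hyps by (subst sum_distrib_left, intro sum.cong) auto
  ultimately show ?case
    using insert by (simp add: euler_mult)
qed

text \<open>
  The cofactors along a row do not see the entries of that row, so Laplace expansion gives
  the determinant after any replacement of the row.
\<close>

lemma det_replace_row:
  fixes F :: "nat \<Rightarrow> nat \<Rightarrow> 'a :: comm_ring_1"
  assumes "k < n"
  shows "det (mat n n (\<lambda>(i, j). if i = k then r j else F i j)) =
    (\<Sum>j<n. r j * cofactor (mat n n (\<lambda>(i, j). F i j)) k j)"
proof -
  let ?B = "mat n n (\<lambda>(i, j). if i = k then r j else F i j)"
  have "mat_delete ?B k j = mat_delete (mat n n (\<lambda>(i, j). F i j)) k j" for j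
    by (rule eq_matI) (auto simp: mat_delete_def)
  then have "cofactor ?B k j = cofactor (mat n n (\<lambda>(i, j). F i j)) k j" for j
    by (simp add: cofactor_def)
  then show ?thesis
    using assms by (subst laplace_expansion_row[of _ n k]) auto
qed

lemma det_replace_col:
  fixes F :: "nat \<Rightarrow> nat \<Rightarrow> 'a :: comm_ring_1"
  assumes "k < n"
  shows "det (mat n n (\<lambda>(i, j). if j = k then c i else F i j)) =
    (\<Sum>i<n. c i * cofactor (mat n n (\<lambda>(i, j). F i j)) i k)"
proof -
  let ?B = "mat n n (\<lambda>(i, j). if j = k then c i else F i j)"
  have "mat_delete ?B i k = mat_delete (mat n n (\<lambda>(i, j). F i j)) i k" for i
    by (rule eq_matI) (auto simp: mat_delete_def)
  then have "cofactor ?B i k = cofactor (mat n n (\<lambda>(i, j). F i j)) i k" for i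
    by (simp add: cofactor_def)
  then show ?thesis
    using assms by (subst laplace_expansion_column[of _ n k]) auto
qed

text \<open>
  Jacobi's formula. Applying the derivation to one factor in each term of the Leibniz expansion
  differentiates one row, and \<open>det_replace_row\<close> expands the result along that row.
\<close>

lemma euler_det:
  fixes F :: "nat \<Rightarrow> nat \<Rightarrow> ('x, 'a::comm_ring_1) pseries"
  shows "euler (det (mat n n (\<lambda>(i, j). F i j))) =
    (\<Sum>i<n. \<Sum>j<n. euler (F i j) * cofactor (mat n n (\<lambda>(i, j). F i j)) i j)"
proof -
  let ?P = "{p. p permutes {0..<n}}"
  have "euler (det (mat n n (\<lambda>(i, j). F i j))) =
      (\<Sum>p\<in>?P. signof p * euler (\<Prod>i=0..<n. F i (p i)))"
    by (subst det_def'[of _ n]) (simp_all add: euler_sum euler_sign_mult)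
  also have "\<dots> = (\<Sum>p\<in>?P. \<Sum>k<n. signof p * (\<Prod>i=0..<n. if i = k then euler (F k (p i)) else F i (p i)))"
    by (intro sum.cong refl)
       (simp add: euler_prod sum_distrib_left atLeast0LessThan cong: if_cong prod.cong)
  also have "\<dots> = (\<Sum>k<n. \<Sum>p\<in>?P. signof p * (\<Prod>i=0..<n. if i = k then euler (F k (p i)) else F i (p i)))"
    by (rule sum.swap)
  also have "\<dots> = (\<Sum>k<n. det (mat n n (\<lambda>(i, j). if i = k then euler (F k j) else F i j)))"
    by (intro sum.cong refl, subst det_def'[of _ n]) (auto intro!: sum.cong prod.cong)
  also have "\<dots> = (\<Sum>k<n. \<Sum>j<n. euler (F k j) * cofactor (mat n n (\<lambda>(i, j). F i j)) k j)"
    by (intro sum.cong refl) (simp add: det_replace_row)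
  finally show ?thesis .
qed

lemma det_scale_columns:
  fixes F :: "nat \<Rightarrow> nat \<Rightarrow> 'a :: comm_ring_1"
  shows "det (mat n n (\<lambda>(i, j). c j * F i j)) = (\<Prod>j<n. c j) * det (mat n n (\<lambda>(i, j). F i j))"
proof -
  have "(\<Prod>i=0..<n. c (p i)) = (\<Prod>j<n. c j)" if "p permutes {0..<n}" for p
    using prod.permute[OF that, of c] by (simp add: atLeast0LessThan o_def)
  then show ?thesis
    by (simp add: det_def'[of _ n] prod.distrib sum_distrib_left ac_simps)
qed

text \<open>
  Congruence of power series modulo terms of degree at least \<open>n\<close>. It organises the
  induction on the degree: multiplication by a linear form raises \<open>n\<close> by one, and an equality of
  derivatives under \<open>euler\<close> can be integrated if the constant terms agree.
\<close>

definition eq_below_degree :: "nat \<Rightarrow> ('x, 'a) pseries \<Rightarrow> ('x, 'a) pseries \<Rightarrow> bool" where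
  "eq_below_degree n f g \<longleftrightarrow> (\<forall>M. size M < n \<longrightarrow> pseries_coeff f M = pseries_coeff g M)"

lemma eq_below_degree_sum:
  assumes "\<And>x. x \<in> A \<Longrightarrow> eq_below_degree n (f x) (g x)"
  shows "eq_below_degree n (sum f A) (sum g A)"
  using assms by (auto simp: eq_below_degree_def pseries_coeff_sum)

lemma eq_below_degree_add: "eq_below_degree n f g \<Longrightarrow> eq_below_degree n f' g' \<Longrightarrow> eq_below_degree n (f + f') (g + g')"
  by (simp add: eq_below_degree_def plus_pseries.rep_eq)

lemma eq_below_degree_diff: "eq_below_degree n f g \<Longrightarrow> eq_below_degree n f' g' \<Longrightarrow> eq_below_degree n (f - f') (g - g')"
  by (simp add: eq_below_degree_def minus_pseries.rep_eq)

lemma eq_below_degree_minus_one_power_times: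
  "eq_below_degree n f g \<Longrightarrow> eq_below_degree n ((-1) ^ k * f) ((-1) ^ k * g)"
  by (cases "even k") (simp_all add: eq_below_degree_def uminus_pseries.rep_eq)

lemma eq_below_degree_linear_form_times:
  assumes "eq_below_degree n f g"
  shows "eq_below_degree (Suc n) (linear_form c * f) (linear_form c * g)"
  unfolding eq_below_degree_def
proof (intro allI impI)
  fix M :: "'a multiset"
  assume M: "size M < Suc n"
  have "pseries_coeff f (M - {#x#}) = pseries_coeff g (M - {#x#})" if "x \<in># M" for x
  proof -
    have "size (M - {#x#}) < n"
      using that M by (metis Suc_less_eq insert_DiffM size_add_mset)
    then show ?thesis
      using assms by (simp add: eq_below_degree_def)
  qed
  then show "pseries_coeff (linear_form c * f) M = pseries_coeff (linear_form c * g) M"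
    by (simp add: pseries_coeff_linear_form_times)
qed

lemma eq_below_degree_of_euler:
  fixes f g :: "('x, 'a::{idom, ring_char_0}) pseries"
  assumes "eq_below_degree n (euler f) (euler g)" "pseries_coeff f {#} = pseries_coeff g {#}"
  shows "eq_below_degree n f g"
  unfolding eq_below_degree_def
proof (intro allI impI)
  fix M :: "'x multiset"
  assume "size M < n"
  then have "of_nat (size M) * pseries_coeff f M = of_nat (size M) * pseries_coeff g M"
    using assms(1) by (simp add: eq_below_degree_def euler.rep_eq)
  then show "pseries_coeff f M = pseries_coeff g M"
    using assms(2) by (cases "M = {#}") auto
qed

lemma pseries_eq_of_eq_below_degree: "(\<And>n. eq_below_degree n f g) \<Longrightarrow> f = g"
  by (rule pseries_eqI) (auto simp: eq_below_degree_def)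

section \<open>Slater states and the action of the currents\<close>

definition vac :: fock where "vac = ket []"

text \<open>
  The list \<open>ts\<close> is read from the vacuum outwards, so that its head acts first, whereas the head of \<open>ss\<close>
  acts last: the state is \<open>\<psi>\<^bsub>s\<^sub>1\<^esub> \<dots> \<psi>\<^bsub>s\<^sub>m\<^esub> \<psi>\<^sup>*\<^bsub>t\<^sub>m\<^esub> \<dots> \<psi>\<^sup>*\<^bsub>t\<^sub>1\<^esub> |\<emptyset>\<rangle>\<close>. With this convention \<open>\<psi>\<close> at \<open>s\<^sub>p\<close> and \<open>\<psi>\<^sup>*\<close> at \<open>t\<^sub>q\<close>
  become neighbours at the cost of the sign \<open>(-1)\<^bsup>p+q\<^esup>\<close>, which is the sign of a cofactor.
\<close>

definition slater :: "int list \<Rightarrow> int list \<Rightarrow> fock" where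
  "slater ss ts = foldr psi ss (fold psi_star ts vac)"

definition del_nth :: "nat \<Rightarrow> 'a list \<Rightarrow> 'a list" where
  "del_nth p xs = take p xs @ drop (Suc p) xs"

lemma occupied_vac: "occupied (maya_of []) = {..0}"
proof -
  have "x \<in> {int (part [] i) - int i + 1 | i. 1 \<le> i}" if "x \<le> 0" for x
    by (rule CollectI, rule exI[of _ "nat (1 - x)"]) (use that in \<open>auto simp: part_def\<close>)
  then show ?thesis
    unfolding maya_of.rep_eq by (force simp: part_def)
qed

lemma psi_sum: "psi i (\<Sum>x\<in>A. f x) = (\<Sum>x\<in>A. psi i (f x))"
  by (induction A rule: infinite_finite_induct) (simp_all add: psi_add)

lemma psi_star_sum: "psi_star i (\<Sum>x\<in>A. f x) = (\<Sum>x\<in>A. psi_star i (f x))"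
  by (induction A rule: infinite_finite_induct) (simp_all add: psi_star_add)

lemma fscale_minus_one: "fscale (- 1) v = - v"
  by (rule poly_mapping_eqI) simp

lemma fscale_minus_left: "fscale (- c) v = - fscale c v"
  by (rule poly_mapping_eqI) simp

lemma fscale_diff_right: "fscale c (v - w) = fscale c v - fscale c w"
  by (rule poly_mapping_eqI) (simp add: lookup_minus algebra_simps)

lemma psi_minus: "psi i (- v) = - psi i v"
  using psi_fscale[of i "- 1" v] by (simp add: fscale_minus_one)

lemma psi_star_minus: "psi_star i (- v) = - psi_star i v"
  using psi_star_fscale[of i "- 1" v] by (simp add: fscale_minus_one)

lemma psi_diff: "psi i (v - w) = psi i v - psi i w"
  using psi_add[of i v "- w"] by (simp add: psi_minus)

lemma psi_star_diff: "psi_star i (v - w) = psi_star i v - psi_star i w"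
  using psi_star_add[of i v "- w"] by (simp add: psi_star_minus)

lemma psi_psi': "psi i (psi j v) = - psi j (psi i v)"
  using psi_psi[of i j v] by (simp add: eq_neg_iff_add_eq_0)

lemma psi_star_psi_star': "psi_star i (psi_star j v) = - psi_star j (psi_star i v)"
  using psi_star_psi_star[of i j v] by (simp add: eq_neg_iff_add_eq_0)

lemma psi_psi_star': "psi i (psi_star j v) = (if i = j then v else 0) - psi_star j (psi i v)"
  using psi_psi_star[of i j v] by (simp add: eq_diff_eq)

lemma psi_star_psi': "psi_star j (psi i v) = (if i = j then v else 0) - psi i (psi_star j v)"
  using psi_psi_star[of i j v] by (simp add: eq_diff_eq add.commute)

text \<open>
  Normal ordering changes \<open>\<psi>\<^sub>i \<psi>\<^sup>*\<^sub>j\<close> by a scalar only, so the commutators with a fermion are those of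
  \<open>\<psi>\<^sub>i \<psi>\<^sup>*\<^sub>j\<close>.
\<close>

lemma normal_ordered_psi:
  "normal_ordered i j (psi s v) = psi s (normal_ordered i j v) + (if s = j then psi i v else 0)"
  by (auto simp: normal_ordered_def psi_star_psi'[of j s] psi_psi'[of i s] psi_minus
      psi_diff psi_star_minus)

lemma normal_ordered_psi_star:
  "normal_ordered i j (psi_star t v) = psi_star t (normal_ordered i j v) - (if t = i then psi_star j v else 0)"
  by (auto simp: normal_ordered_def psi_psi_star'[of i t] psi_star_psi_star'[of j t]
      psi_star_minus psi_star_diff psi_minus)

lemma foldr_psi_linear:
  "foldr psi ss (v + w) = foldr psi ss v + foldr psi ss w"
  "foldr psi ss (fscale c v) = fscale c (foldr psi ss v)"
  "foldr psi ss 0 = 0"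
  "foldr psi ss (- v) = - foldr psi ss v"
  by (induction ss) (simp_all add: psi_add psi_fscale psi_minus)

lemma foldr_psi_sum: "foldr psi ss (\<Sum>x\<in>A. f x) = (\<Sum>x\<in>A. foldr psi ss (f x))"
  by (induction A rule: infinite_finite_induct) (simp_all add: foldr_psi_linear)

lemma fold_psi_star_linear:
  "fold psi_star ts (v + w) = fold psi_star ts v + fold psi_star ts w"
  "fold psi_star ts 0 = 0"
  "fold psi_star ts (- v) = - fold psi_star ts v"
  by (induction ts arbitrary: v w) (simp_all add: psi_star_add psi_star_minus)

text \<open>
  Commuting with a product acts as a derivation: each factor \<open>\<psi>\<^sub>j\<close> in turn is replaced by \<open>\<psi>\<^sub>i\<close>.
\<close>

lemma normal_ordered_foldr_psi:
  "normal_ordered i j (foldr psi ss v) = foldr psi ss (normal_ordered i j v) +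
    (\<Sum>p<length ss. if ss ! p = j then foldr psi (ss[p := i]) v else 0)"
proof (induction ss)
  case (Cons s ss)
  show ?case
    by (simp add: normal_ordered_psi Cons.IH psi_add psi_sum sum.lessThan_Suc_shift
        if_distrib[of "psi s"] del: sum.lessThan_Suc cong: if_cong)
qed simp

lemma normal_ordered_fold_psi_star:
  "normal_ordered i j (fold psi_star ts v) = fold psi_star ts (normal_ordered i j v) -
    (\<Sum>q<length ts. if ts ! q = i then fold psi_star (ts[q := j]) v else 0)"
proof (induction ts arbitrary: v)
  case (Cons t ts)
  have "fold psi_star ts (v - w) = fold psi_star ts v - fold psi_star ts w" for v w
    using fold_psi_star_linear(1)[of ts v "- w"] by (simp add: fold_psi_star_linear)
  then show ?case
    by (simp add: Cons.IH normal_ordered_psi_star fold_psi_star_linear sum.lessThan_Suc_shift cong: if_cong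
        del: sum.lessThan_Suc)
qed simp

lemma psi_vac: "i \<le> 0 \<Longrightarrow> psi i vac = 0"
  by (simp add: vac_def ket_def psi_single occupied_vac)

lemma psi_star_vac: "j > 0 \<Longrightarrow> psi_star j vac = 0"
  by (simp add: vac_def ket_def psi_star_single occupied_vac)

text \<open>
  Triangular currents kill the vacuum: moving a fermion from \<open>j\<close>
  down to \<open>i\<close> means either taking it from an empty place or putting it into an occupied one.
\<close>

lemma normal_ordered_vac: "i \<le> j \<Longrightarrow> normal_ordered i j vac = 0"
  by (simp add: normal_ordered_def psi_vac psi_star_vac)

lemma psi_star_fold_psi_star:
  "psi_star j (fold psi_star ts v) = fscale ((- 1) ^ length ts) (fold psi_star ts (psi_star j v))"
proof (induction ts arbitrary: v)
  case (Cons t ts)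
  show ?case
    by (simp add: psi_star_psi_star'[of j t] fold_psi_star_linear Cons.IH fscale_minus_left fscale_minus_right)
qed simp

lemma fold_psi_star_positive:
  assumes "q < length ts" "j > 0"
  shows "fold psi_star (ts[q := j]) vac = 0"
  using assms
  by (simp add: upd_conv_take_nth_drop psi_star_fold_psi_star psi_star_vac fold_psi_star_linear)

text \<open>
  Moving \<open>\<psi>\<^sub>i\<close> towards the vacuum leaves a contraction with every \<open>\<psi>\<^sup>*\<^sub>i\<close> that it passes.
\<close>

lemma psi_fold_psi_star:
  "psi i (fold psi_star ts v) =
    (\<Sum>q<length ts. if ts ! q = i
       then fscale ((- 1) ^ (length ts - Suc q)) (fold psi_star (del_nth q ts) v) else 0) +
    fscale ((- 1) ^ length ts) (fold psi_star ts (psi i v))"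
proof (induction ts rule: rev_induct)
  case (snoc t ts)
  have sign: "(- 1 :: complex) ^ (length ts - q) = - ((- 1) ^ (length ts - Suc q))"
    if "q < length ts" for q
    using that by (metis Suc_diff_Suc power_Suc mult_minus1)
  have "psi i (fold psi_star (ts @ [t]) v) =
      (if i = t then fold psi_star ts v else 0) - psi_star t (psi i (fold psi_star ts v))"
    by (simp add: psi_psi_star')
  also have "psi_star t (psi i (fold psi_star ts v)) = 
    (\<Sum>q<length ts. if ts ! q = i
       then fscale ((- 1) ^ (length ts - Suc q)) (fold psi_star (del_nth q ts @ [t]) v) else 0) +
    fscale ((- 1) ^ length ts) (fold psi_star (ts @ [t]) (psi i v))"
    by (simp add: snoc.IH psi_star_add psi_star_sum psi_star_fscale if_distrib[of "psi_star t"] cong: if_cong)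
  also have "(\<Sum>q<length ts. if ts ! q = i
       then fscale ((- 1) ^ (length ts - Suc q)) (fold psi_star (del_nth q ts @ [t]) v) else 0) =
     - (\<Sum>q<length ts. if (ts @ [t]) ! q = i
       then fscale ((- 1) ^ (length (ts @ [t]) - Suc q)) (fold psi_star (del_nth q (ts @ [t])) v) else 0)"
    unfolding sum_negf[symmetric]
    by (intro sum.cong refl)
       (auto simp: nth_append del_nth_def sign fscale_minus_left)
  finally show ?case
    by (simp add: del_nth_def fscale_minus_left)
qed simp

lemma psi_foldr_psi:
  "psi i (foldr psi ss v) = fscale ((- 1) ^ length ss) (foldr psi ss (psi i v))"
proof (induction ss)
  case (Cons s ss)
  show ?case
    by (simp add: psi_psi'[of i s] psi_fscale Cons.IH fscale_minus_left fscale_minus_right)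
qed simp

lemma foldr_psi_update:
  assumes "p < length ss"
  shows "foldr psi (ss[p := i]) v =
    fscale ((- 1) ^ (length ss - Suc p)) (foldr psi (del_nth p ss) (psi i v))"
  using assms
  by (simp add: upd_conv_take_nth_drop del_nth_def psi_foldr_psi foldr_psi_linear)

text \<open>
  A factor \<open>\<psi>\<^sub>i\<close> with \<open>i \<le> 0\<close> kills the vacuum, so only its contractions with the \<open>\<psi>\<^sup>*\<close> survive. The two
  moves next to each other contribute \<open>(-1)\<^bsup>m-1-p\<^esup>\<close> and \<open>(-1)\<^bsup>m-1-q\<^esup>\<close>.
\<close>

lemma slater_update_nonpos:
  assumes "i \<le> 0" "p < length ss" "length ts = length ss"
  shows "slater (ss[p := i]) ts = (\<Sum>q<length ts. if ts ! q = i
       then fscale ((- 1) ^ (p + q)) (slater (del_nth p ss) (del_nth q ts)) else 0)"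
proof -
  have "(- 1 :: complex) ^ (length ss - Suc p) * (- 1) ^ (length ss - Suc q) = (- 1) ^ (p + q)"
    if "q < length ss" for q
  proof -
    have "length ss - Suc p + (length ss - Suc q) + (p + q) = 2 * (length ss - 1)"
      using that assms by simp
    then have "(- 1 :: complex) ^ (length ss - Suc p) * (- 1) ^ (length ss - Suc q) * (- 1) ^ (p + q) = 1"
      by (simp flip: power_add)
    moreover have "(- 1 :: complex) ^ (p + q) * (- 1) ^ (p + q) = 1"
      by (simp flip: power_add)
    ultimately show ?thesis
      by (metis mult.assoc mult_1 mult_1_right)
  qed
  then show ?thesis
    using assms
    by (auto simp: slater_def foldr_psi_update psi_fold_psi_star psi_vac fold_psi_star_linear
        foldr_psi_sum foldr_psi_linear if_distrib[of "foldr psi _"] if_distrib[of "fscale _"]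
        fscale_sum fscale_fscale cong: if_cong intro!: sum.cong)
qed

lemma normal_ordered_slater:
  assumes "i \<le> j"
  shows "normal_ordered i j (slater ss ts) =
    (\<Sum>p<length ss. if ss ! p = j then slater (ss[p := i]) ts else 0) -
    (\<Sum>q<length ts. if ts ! q = i then slater ss (ts[q := j]) else 0)"
  using assms
  by (simp add: slater_def normal_ordered_foldr_psi normal_ordered_fold_psi_star
      normal_ordered_vac fold_psi_star_linear foldr_psi_linear foldr_psi_sum
      if_distrib[of "foldr psi _"] cong: if_cong)

text \<open>
  There is no counterpart of the contractions here: \<open>\<psi>\<^sup>*\<^sub>j\<close> with \<open>j > 0\<close> has only other \<open>\<psi>\<^sup>*\<close> between itself
  and the vacuum, which it kills. Hence each contraction of a particle with a hole is counted once.
\<close>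

lemma slater_update_positive:
  assumes "j > 0" "q < length ts"
  shows "slater ss (ts[q := j]) = 0"
  using assms by (simp add: slater_def fold_psi_star_positive foldr_psi_linear)

lemma current_eq_sum:
  assumes "finite B" "{x. (case x of (i, j) \<Rightarrow>
     fscale (current_coeff \<alpha> \<beta> k i j) (normal_ordered i j v)) \<noteq> 0} \<subseteq> B \<times> B"
  shows "current \<alpha> \<beta> k v =
    (\<Sum>i\<in>B. \<Sum>j\<in>B. fscale (current_coeff \<alpha> \<beta> k i j) (normal_ordered i j v))"
  unfolding current_def
  by (subst Sum_any.expand_superset[OF _ assms(2)]) (use assms(1) in \<open>auto simp: sum.cartesian_product\<close>)

text \<open>
  On a fixed vector, a current is the sum over any sufficiently large box of indices. Several vectors can
  thus be treated with the same finite sum.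
\<close>

lemma current_box:
  obtains n :: int where "\<And>m. n \<le> m \<Longrightarrow> current \<alpha> \<beta> k v =
    (\<Sum>i\<in>{-m..m}. \<Sum>j\<in>{-m..m}. fscale (current_coeff \<alpha> \<beta> k i j) (normal_ordered i j v))"
proof -
  let ?S = "{x. (case x of (i, j) \<Rightarrow>
     fscale (current_coeff \<alpha> \<beta> k i j) (normal_ordered i j v)) \<noteq> 0}"
  have "finite ((\<lambda>(i, j). max \<bar>i\<bar> \<bar>j\<bar>) ` ?S)"
    using finite_current_support by blast
  then obtain n where n: "\<forall>x\<in>(\<lambda>(i, j). max \<bar>i\<bar> \<bar>j\<bar>) ` ?S. x \<le> n"
    by (meson bdd_above_finite bdd_above_def)
  show thesis
  proof (rule that[of n])
    fix m assume "n \<le> m"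
    have "?S \<subseteq> {-m..m} \<times> {-m..m}"
    proof
      fix x assume "x \<in> ?S"
      then have "max \<bar>fst x\<bar> \<bar>snd x\<bar> \<le> n"
        using n by (force simp: case_prod_unfold)
      then show "x \<in> {-m..m} \<times> {-m..m}"
        using \<open>n \<le> m\<close> by (cases x) auto
    qed
    then show "current \<alpha> \<beta> k v =
       (\<Sum>i\<in>{-m..m}. \<Sum>j\<in>{-m..m}. fscale (current_coeff \<alpha> \<beta> k i j) (normal_ordered i j v))"
      by (intro current_eq_sum) auto
  qed
qed

lemma normal_ordered_fscale: "normal_ordered i j (fscale c v) = fscale c (normal_ordered i j v)"
  by (simp add: normal_ordered_def psi_fscale psi_star_fscale fscale_minus_right)

lemma current_add: "current \<alpha> \<beta> k (v + w) = current \<alpha> \<beta> k v + current \<alpha> \<beta> k w"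
proof -
  obtain n1 where n1: "\<And>m. n1 \<le> m \<Longrightarrow> current \<alpha> \<beta> k v =
    (\<Sum>i\<in>{-m..m}. \<Sum>j\<in>{-m..m}. fscale (current_coeff \<alpha> \<beta> k i j) (normal_ordered i j v))"
    using current_box by blast
  obtain n2 where n2: "\<And>m. n2 \<le> m \<Longrightarrow> current \<alpha> \<beta> k w =
    (\<Sum>i\<in>{-m..m}. \<Sum>j\<in>{-m..m}. fscale (current_coeff \<alpha> \<beta> k i j) (normal_ordered i j w))"
    using current_box by blast
  obtain n3 where n3: "\<And>m. n3 \<le> m \<Longrightarrow> current \<alpha> \<beta> k (v + w) =
    (\<Sum>i\<in>{-m..m}. \<Sum>j\<in>{-m..m}. fscale (current_coeff \<alpha> \<beta> k i j) (normal_ordered i j (v + w)))"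
    using current_box by blast
  define m where "m = max n1 (max n2 n3)"
  show ?thesis
    by (subst n1[of m], simp add: m_def, subst n2[of m], simp add: m_def,
        subst n3[of m], simp add: m_def)
       (simp add: normal_ordered_add fscale_add_right sum.distrib)
qed

lemma current_fscale: "current \<alpha> \<beta> k (fscale c v) = fscale c (current \<alpha> \<beta> k v)"
proof -
  obtain n1 where n1: "\<And>m. n1 \<le> m \<Longrightarrow> current \<alpha> \<beta> k v =
    (\<Sum>i\<in>{-m..m}. \<Sum>j\<in>{-m..m}. fscale (current_coeff \<alpha> \<beta> k i j) (normal_ordered i j v))"
    using current_box by blast
  obtain n2 where n2: "\<And>m. n2 \<le> m \<Longrightarrow> current \<alpha> \<beta> k (fscale c v) =
    (\<Sum>i\<in>{-m..m}. \<Sum>j\<in>{-m..m}. fscale (current_coeff \<alpha> \<beta> k i j) (normal_ordered i j (fscale c v)))"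
    using current_box by blast
  define m where "m = max n1 n2"
  show ?thesis
    by (subst n1[of m], simp add: m_def, subst n2[of m], simp add: m_def)
       (simp add: normal_ordered_fscale fscale_sum fscale_fscale ac_simps)
qed

text \<open>
  Collecting the commutators with all factors: a particle moved to a place \<open>u \<ge> 1\<close>, a particle moved
  to a place \<open>u \<le> 0\<close>, where it has to fill one of the holes \<open>t\<^sub>q\<close>, and a hole moved up to a place \<open>u \<le> 0\<close>.
\<close>

lemma current_slater:
  assumes len: "length ts = length ss" and pos: "\<forall>s\<in>set ss. s > 0" and neg: "\<forall>t\<in>set ts. t \<le> 0"
  shows "current \<alpha> \<beta> k (slater ss ts) =
    (\<Sum>p<length ss. \<Sum>u\<in>{1..ss ! p}. fscale (current_coeff \<alpha> \<beta> k u (ss ! p)) (slater (ss[p := u]) ts)) +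
    (\<Sum>p<length ss. \<Sum>q<length ts. fscale ((- 1) ^ (p + q) * current_coeff \<alpha> \<beta> k (ts ! q) (ss ! p))
        (slater (del_nth p ss) (del_nth q ts))) -
    (\<Sum>q<length ts. \<Sum>u\<in>{ts ! q..0}. fscale (current_coeff \<alpha> \<beta> k (ts ! q) u) (slater ss (ts[q := u])))"
proof -
  let ?c = "current_coeff \<alpha> \<beta> k"
  obtain n where n: "\<And>m. n \<le> m \<Longrightarrow> current \<alpha> \<beta> k (slater ss ts) =
    (\<Sum>i\<in>{-m..m}. \<Sum>j\<in>{-m..m}. fscale (?c i j) (normal_ordered i j (slater ss ts)))"
    using current_box by blast
  obtain b where b: "\<forall>x\<in>abs ` (set ss \<union> set ts). x \<le> b"
    by (meson List.finite_set bdd_above_def bdd_above_finite finite_UnI finite_imageI)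
  \<comment> \<open>The box contains all the indices in the two lists, so that the Kronecker deltas hit it.\<close>
  define m where "m = max 0 (max n b)"
  let ?B = "{-m..m}"
  have m0: "0 \<in> ?B" and ss: "ss ! p \<in> ?B" if "p < length ss" for p
    using b nth_mem[OF that] by (force simp: m_def)+
  have ts: "ts ! q \<in> ?B" if "q < length ts" for q
    using b nth_mem[OF that] by (force simp: m_def)
  have low: "?c i j = 0" if "j < i" for i j
    using that by (simp add: current_coeff_def)
  have "current \<alpha> \<beta> k (slater ss ts) =
      (\<Sum>i\<in>?B. \<Sum>j\<in>?B. fscale (?c i j) (normal_ordered i j (slater ss ts)))"
    by (rule n) (simp add: m_def)
  also have "\<dots> = (\<Sum>i\<in>?B. \<Sum>j\<in>?B.
      (\<Sum>p<length ss. if ss ! p = j then fscale (?c i j) (slater (ss[p := i]) ts) else 0) -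
      (\<Sum>q<length ts. if ts ! q = i then fscale (?c i j) (slater ss (ts[q := j])) else 0))"
  proof (intro sum.cong refl)
    fix i j
    show "fscale (?c i j) (normal_ordered i j (slater ss ts)) =
      (\<Sum>p<length ss. if ss ! p = j then fscale (?c i j) (slater (ss[p := i]) ts) else 0) -
      (\<Sum>q<length ts. if ts ! q = i then fscale (?c i j) (slater ss (ts[q := j])) else 0)"
    proof (cases "i \<le> j")
      case True
      then show ?thesis
        by (simp add: normal_ordered_slater fscale_diff_right fscale_sum
            if_distrib[of "fscale _"] cong: if_cong)
    qed (simp add: low cong: if_cong)
  qed
  also have "\<dots> = (\<Sum>i\<in>?B. \<Sum>j\<in>?B. \<Sum>p<length ss. if ss ! p = j then fscale (?c i j) (slater (ss[p := i]) ts) else 0) -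
      (\<Sum>i\<in>?B. \<Sum>j\<in>?B. \<Sum>q<length ts. if ts ! q = i then fscale (?c i j) (slater ss (ts[q := j])) else 0)"
    by (simp add: sum_subtractf)
  also have "(\<Sum>i\<in>?B. \<Sum>j\<in>?B. \<Sum>q<length ts. if ts ! q = i then fscale (?c i j) (slater ss (ts[q := j])) else 0)
     = (\<Sum>q<length ts. \<Sum>j\<in>?B. \<Sum>i\<in>?B. if ts ! q = i then fscale (?c i j) (slater ss (ts[q := j])) else 0)"
    by (subst sum.swap, subst sum.swap[of _ "{..<length ts}"])
       (intro sum.cong refl sum.swap)
  also have "\<dots> = (\<Sum>q<length ts. \<Sum>u\<in>{ts ! q..0}. fscale (?c (ts ! q) u) (slater ss (ts[q := u])))"
  proof (rule sum.cong[OF refl])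
    fix q assume "q \<in> {..<length ts}"
    then have q: "q < length ts" by simp
    have "(\<Sum>j\<in>?B. \<Sum>i\<in>?B. if ts ! q = i then fscale (?c i j) (slater ss (ts[q := j])) else 0) =
        (\<Sum>j\<in>?B. fscale (?c (ts ! q) j) (slater ss (ts[q := j])))"
      using ts[OF q] by (simp add: sum.delta)
    also have "\<dots> = (\<Sum>j\<in>{ts ! q..0}. fscale (?c (ts ! q) j) (slater ss (ts[q := j])))"
      using ts[OF q] low q by (intro sum.mono_neutral_right) (auto simp: slater_update_positive not_le)
    finally show "(\<Sum>j\<in>?B. \<Sum>i\<in>?B. if ts ! q = i then fscale (?c i j) (slater ss (ts[q := j])) else 0) = \<dots>" .
  qed
  also have "(\<Sum>i\<in>?B. \<Sum>j\<in>?B. \<Sum>p<length ss. if ss ! p = j then fscale (?c i j) (slater (ss[p := i]) ts) else 0)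
     = (\<Sum>p<length ss. \<Sum>i\<in>?B. \<Sum>j\<in>?B. if ss ! p = j then fscale (?c i j) (slater (ss[p := i]) ts) else 0)"
    by (subst sum.swap[of _ _ "{..<length ss}"]) (intro sum.cong refl sum.swap)
  also have "\<dots> = (\<Sum>p<length ss. (\<Sum>u\<in>{1..ss ! p}. fscale (?c u (ss ! p)) (slater (ss[p := u]) ts)) +
      (\<Sum>q<length ts. fscale ((- 1) ^ (p + q) * ?c (ts ! q) (ss ! p)) (slater (del_nth p ss) (del_nth q ts))))"
  proof (rule sum.cong[OF refl])
    fix p assume "p \<in> {..<length ss}"
    then have p: "p < length ss" by simp
    let ?f = "\<lambda>i. fscale (?c i (ss ! p)) (slater (ss[p := i]) ts)"
    have "(\<Sum>i\<in>?B. \<Sum>j\<in>?B. if ss ! p = j then fscale (?c i j) (slater (ss[p := i]) ts) else 0) = sum ?f ?B"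
      using ss[OF p] by (simp add: sum.delta)
    \<comment> \<open>Landing in a positive place keeps the shape of the state, landing in a nonpositive one contracts.\<close>
    also have "sum ?f ?B = sum ?f {1..m} + sum ?f {-m..0}"
    proof -
      have "?B = {1..m} \<union> {-m..0}"
        using m0[OF p] by auto
      then show ?thesis
        by (simp only:) (rule sum.union_disjoint, auto)
    qed
    also have "sum ?f {1..m} = sum ?f {1..ss ! p}"
      using ss[OF p] low by (intro sum.mono_neutral_right) (auto simp: not_le)
    also have "sum ?f {-m..0} = (\<Sum>i\<in>{-m..0}. \<Sum>q<length ts. if ts ! q = i
        then fscale ((- 1) ^ (p + q) * ?c i (ss ! p)) (slater (del_nth p ss) (del_nth q ts)) else 0)"
      using p len by (intro sum.cong refl)
        (simp add: slater_update_nonpos fscale_sum fscale_fscale mult.commute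
          if_distrib[of "fscale _"] cong: if_cong)
    also have "\<dots> = (\<Sum>q<length ts. \<Sum>i\<in>{-m..0}. if ts ! q = i
        then fscale ((- 1) ^ (p + q) * ?c i (ss ! p)) (slater (del_nth p ss) (del_nth q ts)) else 0)"
      by (rule sum.swap)
    also have "\<dots> = (\<Sum>q<length ts. fscale ((- 1) ^ (p + q) * ?c (ts ! q) (ss ! p)) (slater (del_nth p ss) (del_nth q ts)))"
    proof (rule sum.cong[OF refl])
      fix q assume "q \<in> {..<length ts}"
      then have "ts ! q \<in> {-m..0}"
        using ts[of q] neg nth_mem[of q ts] by auto
      then show "(\<Sum>i\<in>{-m..0}. if ts ! q = i
        then fscale ((- 1) ^ (p + q) * ?c i (ss ! p)) (slater (del_nth p ss) (del_nth q ts)) else 0) = fscale ((- 1) ^ (p + q) * ?c (ts ! q) (ss ! p)) (slater (del_nth p ss) (del_nth q ts))"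
        by (simp add: sum.delta)
    qed
    finally show "(\<Sum>i\<in>?B. \<Sum>j\<in>?B. if ss ! p = j then fscale (?c i j) (slater (ss[p := i]) ts) else 0) =
       sum ?f {1..ss ! p} + \<dots>" .
  qed
  finally show ?thesis
    by (simp add: sum.distrib)
qed

section \<open>Vacuum expectations and Wick's theorem\<close>

text \<open>
  The series \<open>\<langle>\<emptyset>| e\<^bsup>H\<^sub>+\<^esup> |v\<rangle>\<close> for an arbitrary vector \<open>v\<close>; the double factorial Schur functions are its
  values at the basis vectors.
\<close>

definition vacuum_series :: "(int \<Rightarrow> complex) \<Rightarrow> (int \<Rightarrow> complex) \<Rightarrow> fock \<Rightarrow> (nat, complex) pseries" where
  "vacuum_series \<alpha> \<beta> v = Abs_pseries (\<lambda>M. bra [] (exp_H_plus \<alpha> \<beta> (const_series v) M))"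

lemma double_schur_eq_vacuum_series: "double_schur \<alpha> \<beta> l = vacuum_series \<alpha> \<beta> (ket l)"
  by (simp add: double_schur_def vacuum_series_def)

lemma bra_linear:
  "bra l (v + w) = bra l v + bra l w"
  "bra l (fscale c v) = c * bra l v"
  by (simp_all add: bra_def lookup_add)

lemma bra_sum: "bra l (\<Sum>x\<in>A. f x) = (\<Sum>x\<in>A. bra l (f x))"
  by (induction A rule: infinite_finite_induct) (simp_all add: bra_linear, simp_all add: bra_def)

lemma current_sum: "current \<alpha> \<beta> k (\<Sum>x\<in>A. f x) = (\<Sum>x\<in>A. current \<alpha> \<beta> k (f x))"
  by (induction A rule: infinite_finite_induct) (simp_all add: current_add)

lemma sum_mset_swap:
  fixes f :: "'a \<Rightarrow> 'a \<Rightarrow> 'b :: comm_monoid_add"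
  shows "(\<Sum>i\<in>set_mset M. \<Sum>j\<in>set_mset (M - {#i#}). f i j) =
    (\<Sum>j\<in>set_mset M. \<Sum>i\<in>set_mset (M - {#j#}). f i j)"
proof -
  have "i \<in># M \<and> j \<in># M - {#i#} \<longleftrightarrow> j \<in># M \<and> i \<in># M - {#j#}" for i j
    by (cases "i = j") (auto simp: in_diff_count)
  then show ?thesis
    unfolding sum.Sigma[OF finite_set_mset ballI[OF finite_set_mset]]
    by (intro sum.reindex_bij_witness[of _ "\<lambda>(i, j). (j, i)" "\<lambda>(i, j). (j, i)"]) auto
qed

text \<open>
  By definition the last of the \<open>n + 1\<close> factors \<open>H\<^sub>+\<close> is applied to a series; here the first one is split
  off, so that the remaining \<open>n\<close> are again applied to a constant series. The indeterminates commute,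
  hence the order in which two of them are removed from a monomial is irrelevant.
\<close>

lemma H_plus_pow_Suc_const:
  "(H_plus \<alpha> \<beta> ^^ Suc n) (const_series v) M =
    (\<Sum>i\<in>set_mset M. fscale (1 / of_nat (i + 1))
      ((H_plus \<alpha> \<beta> ^^ n) (const_series (current \<alpha> \<beta> (i + 1) v)) (M - {#i#})))"
proof (induction n arbitrary: v M)
  case 0
  show ?case
    by (simp add: H_plus_def const_series_def if_distrib[of "current _ _ _"] cong: if_cong)
next
  case (Suc n)
  let ?H = "H_plus \<alpha> \<beta>" and ?J = "\<lambda>i. current \<alpha> \<beta> (i + 1)"
  let ?X = "\<lambda>i j. fscale (1 / of_nat (i + 1)) (fscale (1 / of_nat (j + 1))
     (?J i ((?H ^^ n) (const_series (?J j v)) (M - {#i#} - {#j#}))))"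
  have step: "(?H ^^ Suc m) f N =
      (\<Sum>i\<in>set_mset N. fscale (1 / of_nat (i + 1)) (?J i ((?H ^^ m) f (N - {#i#}))))" for m f N
    by (simp add: H_plus_def[of _ _ "(?H ^^ m) f"])
  have "(?H ^^ Suc (Suc n)) (const_series v) M =
      (\<Sum>i\<in>set_mset M. \<Sum>j\<in>set_mset (M - {#i#}). ?X i j)"
    by (simp only: step[of "Suc n"] Suc.IH current_sum current_fscale fscale_sum)
  also have "\<dots> = (\<Sum>j\<in>set_mset M. \<Sum>i\<in>set_mset (M - {#j#}). ?X i j)"
    by (rule sum_mset_swap)
  also have "\<dots> = (\<Sum>j\<in>set_mset M. fscale (1 / of_nat (j + 1))
      ((?H ^^ Suc n) (const_series (?J j v)) (M - {#j#})))"
    by (simp only: step[of n] fscale_sum fscale_fscale mult.commute diff_right_commute)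
  finally show ?case .
qed

lemma H_plus_pow_const_eq_0:
  assumes "n < size M"
  shows "(H_plus \<alpha> \<beta> ^^ n) (const_series v) M = 0"
  using assms
proof (induction n arbitrary: v M)
  case 0
  then show ?case by (auto simp: const_series_def)
next
  case (Suc n)
  have "n < size (M - {#i#})" if "i \<in># M" for i
    using that Suc.prems by (simp add: size_Diff_singleton)
  then show ?case
    by (simp add: H_plus_pow_Suc_const Suc.IH del: funpow.simps)
qed

text \<open>
  Homogeneity: in degree \<open>n\<close>, only the \<open>n\<close>-th term of the exponential series contributes.
\<close>

lemma pseries_coeff_vacuum_series:
  "pseries_coeff (vacuum_series \<alpha> \<beta> v) M =
    bra [] ((H_plus \<alpha> \<beta> ^^ size M) (const_series v) M) / fact (size M)"
proof -
  have "(H_plus \<alpha> \<beta> ^^ n) (const_series v) M = 0" if "n \<noteq> size M" for n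
    using that H_plus_pow_eq_0 H_plus_pow_const_eq_0 by (metis linorder_neqE_nat)
  then have "{n. fscale (1 / fact n) ((H_plus \<alpha> \<beta> ^^ n) (const_series v) M) \<noteq> 0} \<subseteq> {size M}"
    using fscale_0_right by fastforce
  then have "exp_H_plus \<alpha> \<beta> (const_series v) M =
      fscale (1 / fact (size M)) ((H_plus \<alpha> \<beta> ^^ size M) (const_series v) M)"
    unfolding exp_H_plus_def by (subst Sum_any.expand_superset[of "{size M}"]) auto
  then show ?thesis
    by (simp add: vacuum_series_def Abs_pseries_inverse bra_linear)
qed

lemma pseries_coeff_vacuum_series_empty [simp]:
  "pseries_coeff (vacuum_series \<alpha> \<beta> v) {#} = bra [] v"
  by (simp add: pseries_coeff_vacuum_series const_series_def)

text \<open>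
  The differential equation for the exponential, coefficientwise. The factor \<open>size M\<close> turns
  \<open>1 / n!\<close> into \<open>1 / (n - 1)!\<close>. Together with the constant term this recursion determines the series, and
  linearity in \<open>v\<close> is read off from it below.
\<close>

lemma vacuum_series_euler_coeff:
  "of_nat (size M) * pseries_coeff (vacuum_series \<alpha> \<beta> v) M =
    (\<Sum>k\<in>set_mset M. pseries_coeff (vacuum_series \<alpha> \<beta> (current \<alpha> \<beta> (k + 1) v)) (M - {#k#}) / of_nat (k + 1))"
proof (cases "size M")
  case (Suc n)
  have "size (M - {#k#}) = n" if "k \<in># M" for k
    using that Suc by (simp add: size_Diff_singleton)
  then show ?thesis
    by (simp add: pseries_coeff_vacuum_series Suc H_plus_pow_Suc_const bra_sum bra_linear
        sum_divide_distrib sum_distrib_left field_simps del: funpow.simps of_nat_Suc)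
qed simp

lemma vacuum_series_add:
  "vacuum_series \<alpha> \<beta> (v + w) = vacuum_series \<alpha> \<beta> v + vacuum_series \<alpha> \<beta> w"
proof (rule pseries_eqI)
  fix M
  show "pseries_coeff (vacuum_series \<alpha> \<beta> (v + w)) M =
      pseries_coeff (vacuum_series \<alpha> \<beta> v + vacuum_series \<alpha> \<beta> w) M"
  proof (induction M arbitrary: v w rule: measure_induct_rule[of size])
    case (less M)
    show ?case
    proof (cases "M = {#}")
      case False
      have "size (M - {#k#}) < size M" if "k \<in># M" for k
        using that by (rule size_Diff1_less)
      then have "of_nat (size M) * pseries_coeff (vacuum_series \<alpha> \<beta> (v + w)) M =
          of_nat (size M) * pseries_coeff (vacuum_series \<alpha> \<beta> v + vacuum_series \<alpha> \<beta> w) M"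
        by (simp add: vacuum_series_euler_coeff current_add less.IH plus_pseries.rep_eq
            distrib_left add_divide_distrib sum.distrib)
      then show ?thesis
        using False by simp
    qed (simp add: plus_pseries.rep_eq bra_linear)
  qed
qed

lemma pseries_coeff_vacuum_series_fscale:
  "pseries_coeff (vacuum_series \<alpha> \<beta> (fscale c v)) M = c * pseries_coeff (vacuum_series \<alpha> \<beta> v) M"
proof (induction M arbitrary: v rule: measure_induct_rule[of size])
  case (less M)
  show ?case
  proof (cases "M = {#}")
    case False
    have "size (M - {#k#}) < size M" if "k \<in># M" for k
      using that by (rule size_Diff1_less)
    then have "of_nat (size M) * pseries_coeff (vacuum_series \<alpha> \<beta> (fscale c v)) M =
        c * (of_nat (size M) * pseries_coeff (vacuum_series \<alpha> \<beta> v) M)"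
      by (simp add: vacuum_series_euler_coeff current_fscale less.IH sum_distrib_left)
    then show ?thesis
      using False by simp
  qed (simp add: bra_linear)
qed

lemma vacuum_series_fscale_sign:
  "vacuum_series \<alpha> \<beta> (fscale ((- 1) ^ n) v) = (- 1) ^ n * vacuum_series \<alpha> \<beta> v"
  by (rule pseries_eqI, cases "even n")
     (simp_all add: pseries_coeff_vacuum_series_fscale uminus_pseries.rep_eq)

text \<open>
  With \<open>f k = J\<^bsub>k+1\<^esub> v\<close> this is \<open>\<langle>\<emptyset>| e\<^bsup>H\<^sub>+\<^esup> H\<^sub>+ |v\<rangle>\<close>. Leaving \<open>f\<close> free makes the expression additive in the
  family of vectors, so that an expansion of all the \<open>J\<^sub>k v\<close> can be inserted term by term.
\<close>

lift_definition current_series :: "(int \<Rightarrow> complex) \<Rightarrow> (int \<Rightarrow> complex) \<Rightarrow> (nat \<Rightarrow> fock) \<Rightarrow> (nat, complex) pseries"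
  is "\<lambda>\<alpha> \<beta> f M. \<Sum>k\<in>set_mset M. pseries_coeff (vacuum_series \<alpha> \<beta> (f k)) (M - {#k#}) / of_nat (k + 1)" .

lemma euler_vacuum_series:
  "euler (vacuum_series \<alpha> \<beta> v) = current_series \<alpha> \<beta> (\<lambda>k. current \<alpha> \<beta> (k + 1) v)"
  by (rule pseries_eqI) (simp only: euler.rep_eq current_series.rep_eq vacuum_series_euler_coeff)

lemma current_series_add:
  "current_series \<alpha> \<beta> (\<lambda>k. f k + g k) = current_series \<alpha> \<beta> f + current_series \<alpha> \<beta> g"
  by (rule pseries_eqI)
     (simp add: current_series.rep_eq plus_pseries.rep_eq vacuum_series_add add_divide_distrib sum.distrib)

lemma current_series_diff:
  "current_series \<alpha> \<beta> (\<lambda>k. f k - g k) = current_series \<alpha> \<beta> f - current_series \<alpha> \<beta> g"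
  using current_series_add[of \<alpha> \<beta> "\<lambda>k. f k - g k" g] by simp

lemma current_series_fscale:
  "current_series \<alpha> \<beta> (\<lambda>k. fscale (c k) v) =
    linear_form (\<lambda>k. c k / of_nat (k + 1)) * vacuum_series \<alpha> \<beta> v"
  by (rule pseries_eqI)
     (simp add: current_series.rep_eq pseries_coeff_linear_form_times pseries_coeff_vacuum_series_fscale)

lemma current_series_sum:
  "current_series \<alpha> \<beta> (\<lambda>k. \<Sum>x\<in>A. f x k) = (\<Sum>x\<in>A. current_series \<alpha> \<beta> (f x))"
proof -
  have "current_series \<alpha> \<beta> (\<lambda>k. 0) = 0"
    using current_series_add[of \<alpha> \<beta> "\<lambda>k. 0" "\<lambda>k. 0"] by simp
  then show ?thesis
    by (induction A rule: infinite_finite_induct) (simp_all add: current_series_add)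
qed

text \<open>
  The entry of the matrix of \<open>H\<^sub>+\<close>: the coefficient of \<open>:\<psi>\<^sub>i \<psi>\<^sup>*\<^sub>j:\<close> in \<open>\<Sum>\<^sub>k p\<^sub>k / k J\<^sub>k\<close>.
\<close>

definition H_entry :: "(int \<Rightarrow> complex) \<Rightarrow> (int \<Rightarrow> complex) \<Rightarrow> int \<Rightarrow> int \<Rightarrow> (nat, complex) pseries" where
  "H_entry \<alpha> \<beta> i j = linear_form (\<lambda>k. current_coeff \<alpha> \<beta> (k + 1) i j / of_nat (k + 1))"

text \<open>
  The right-hand side of the differential equation shared by the vacuum expectations and the
  determinants, as an operator on families \<open>X\<close> indexed by particles and holes; \<open>h\<close> stands for the matrix of \<open>H\<^sub>+\<close>.
\<close>

definition wick_rhs :: "(int \<Rightarrow> int \<Rightarrow> 'a) \<Rightarrow> (int list \<Rightarrow> int list \<Rightarrow> 'a) \<Rightarrow> int list \<Rightarrow> int list \<Rightarrow> 'a :: comm_ring_1" where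
  "wick_rhs h X ss ts =
    (\<Sum>p<length ss. \<Sum>u\<in>{1..ss ! p}. h u (ss ! p) * X (ss[p := u]) ts) +
    (\<Sum>p<length ss. \<Sum>q<length ts. (- 1) ^ (p + q) * (h (ts ! q) (ss ! p) * X (del_nth p ss) (del_nth q ts))) -
    (\<Sum>q<length ts. \<Sum>u\<in>{ts ! q..0}. h (ts ! q) u * X ss (ts[q := u]))"

lemma linear_form_sign: "linear_form (\<lambda>k. (- 1) ^ n * c k) = (- 1) ^ n * linear_form c"
  by (rule pseries_eqI, cases "even n")
     (simp_all add: linear_form.rep_eq uminus_pseries.rep_eq sum_negf[symmetric] if_distrib[of uminus] cong: if_cong)

text \<open>
  Particles above and equally many holes in the sea \<open>{..0}\<close>. Repetitions and arbitrary orders have to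
  be allowed, since replacing one entry of a list can produce them.
\<close>

definition admissible :: "int list \<Rightarrow> int list \<Rightarrow> bool" where
  "admissible ss ts \<longleftrightarrow> length ts = length ss \<and> (\<forall>s\<in>set ss. s > 0) \<and> (\<forall>t\<in>set ts. t \<le> 0)"

lemma euler_slater:
  assumes "admissible ss ts"
  shows "euler (vacuum_series \<alpha> \<beta> (slater ss ts)) =
    wick_rhs (H_entry \<alpha> \<beta>) (\<lambda>ss ts. vacuum_series \<alpha> \<beta> (slater ss ts)) ss ts"
proof -
  have len: "length ts = length ss" and pos: "\<forall>s\<in>set ss. s > 0" and neg: "\<forall>t\<in>set ts. t \<le> 0"
    using assms by (auto simp: admissible_def)
  have "linear_form (\<lambda>k. (- 1) ^ n * c k / of_nat (k + 1)) = (- 1) ^ n * linear_form (\<lambda>k. c k / of_nat (k + 1))"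
    for n and c :: "nat \<Rightarrow> complex"
    using linear_form_sign[of n "\<lambda>k. c k / of_nat (k + 1)"] by simp
  then show ?thesis
    unfolding euler_vacuum_series current_slater[OF len pos neg] wick_rhs_def
    by (simp only: current_series_add current_series_diff current_series_sum
        current_series_fscale H_entry_def mult.assoc)
qed

definition pair_det :: "(int \<Rightarrow> int \<Rightarrow> 'a :: comm_ring_1) \<Rightarrow> int list \<Rightarrow> int list \<Rightarrow> 'a" where
  "pair_det D ss ts = det (mat (length ss) (length ss) (\<lambda>(i, j). D (ss ! i) (ts ! j)))"

lemma length_del_nth: "p < length xs \<Longrightarrow> length (del_nth p xs) = length xs - 1"
  by (auto simp: del_nth_def)

lemma nth_del_nth:
  "p < length xs \<Longrightarrow> i < length xs - 1 \<Longrightarrow> del_nth p xs ! i = xs ! (if i < p then i else Suc i)"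
  by (auto simp: del_nth_def nth_append min_def)

lemma pair_det_update_row:
  assumes "p < length ss"
  shows "pair_det D (ss[p := u]) ts = (\<Sum>j<length ss. D u (ts ! j) *
    cofactor (mat (length ss) (length ss) (\<lambda>(i, j). D (ss ! i) (ts ! j))) p j)"
proof -
  have "mat (length ss) (length ss) (\<lambda>(i, j). D (ss[p := u] ! i) (ts ! j)) =
    mat (length ss) (length ss) (\<lambda>(i, j). if i = p then D u (ts ! j) else D (ss ! i) (ts ! j))"
    by (rule eq_matI) auto
  then show ?thesis
    using assms by (simp add: pair_det_def det_replace_row)
qed

lemma pair_det_update_col:
  assumes "q < length ss" "length ts = length ss"
  shows "pair_det D ss (ts[q := u]) = (\<Sum>i<length ss. D (ss ! i) u *
    cofactor (mat (length ss) (length ss) (\<lambda>(i, j). D (ss ! i) (ts ! j))) i q)"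
proof -
  have "mat (length ss) (length ss) (\<lambda>(i, j). D (ss ! i) (ts[q := u] ! j)) =
    mat (length ss) (length ss) (\<lambda>(i, j). if j = q then D (ss ! i) u else D (ss ! i) (ts ! j))"
    using assms by (intro eq_matI) auto
  then show ?thesis
    using assms by (simp add: pair_det_def det_replace_col)
qed

text \<open>
  A cofactor is the determinant for the lists with one particle and one hole removed, with the sign
  that the contraction has in \<open>current_slater\<close>.
\<close>

lemma cofactor_pair_matrix:
  assumes "p < length ss" "q < length ss" "length ts = length ss"
  shows "cofactor (mat (length ss) (length ss) (\<lambda>(i, j). D (ss ! i) (ts ! j))) p q =
    (- 1) ^ (p + q) * pair_det D (del_nth p ss) (del_nth q ts)"
proof -
  have "mat_delete (mat (length ss) (length ss) (\<lambda>(i, j). D (ss ! i) (ts ! j))) p q =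
      mat (length (del_nth p ss)) (length (del_nth p ss)) (\<lambda>(i, j). D (del_nth p ss ! i) (del_nth q ts ! j))"
    using assms by (intro eq_matI) (auto simp: mat_delete_def length_del_nth nth_del_nth)
  then show ?thesis
    by (simp add: cofactor_def pair_det_def)
qed

text \<open>
  In Jacobi's formula, the terms of \<open>euler (D s\<^sub>i t\<^sub>j)\<close> that change \<open>s\<^sub>i\<close> sum over \<open>j\<close> to a Laplace expansion
  along row \<open>i\<close>, those that change \<open>t\<^sub>j\<close> sum over \<open>i\<close> to one along column \<open>j\<close>, and the inhomogeneous term
  multiplies the cofactor.
\<close>

lemma euler_pair_det:
  fixes D :: "int \<Rightarrow> int \<Rightarrow> ('x, 'a :: comm_ring_1) pseries"
  assumes D: "\<And>s t. s > 0 \<Longrightarrow> t \<le> 0 \<Longrightarrow> euler (D s t) =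
      (\<Sum>u\<in>{1..s}. h u s * D u t) + h t s - (\<Sum>u\<in>{t..0}. h t u * D s u)"
  assumes "admissible ss ts"
  shows "euler (pair_det D ss ts) = wick_rhs h (pair_det D) ss ts"
proof -
  have len: "length ts = length ss"
    using assms by (simp add: admissible_def)
  let ?n = "length ss"
  define C where "C = cofactor (mat ?n ?n (\<lambda>(i, j). D (ss ! i) (ts ! j)))"
  have "euler (pair_det D ss ts) = (\<Sum>i<?n. \<Sum>j<?n. euler (D (ss ! i) (ts ! j)) * C i j)"
    by (simp add: pair_det_def euler_det C_def)
  also have "\<dots> = (\<Sum>i<?n. \<Sum>j<?n.
      (\<Sum>u\<in>{1..ss ! i}. h u (ss ! i) * (D u (ts ! j) * C i j)) + h (ts ! j) (ss ! i) * C i j -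
      (\<Sum>u\<in>{ts ! j..0}. h (ts ! j) u * (D (ss ! i) u * C i j)))"
  proof (intro sum.cong refl)
    fix i j assume "i \<in> {..<?n}" "j \<in> {..<?n}"
    then have "ss ! i > 0" "ts ! j \<le> 0"
      using assms(2) by (simp_all add: admissible_def)
    then show "euler (D (ss ! i) (ts ! j)) * C i j = 
      (\<Sum>u\<in>{1..ss ! i}. h u (ss ! i) * (D u (ts ! j) * C i j)) + h (ts ! j) (ss ! i) * C i j -
      (\<Sum>u\<in>{ts ! j..0}. h (ts ! j) u * (D (ss ! i) u * C i j))"
      by (simp add: D algebra_simps sum_distrib_left)
  qed
  also have "\<dots> = (\<Sum>i<?n. \<Sum>j<?n. \<Sum>u\<in>{1..ss ! i}. h u (ss ! i) * (D u (ts ! j) * C i j)) +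
      (\<Sum>i<?n. \<Sum>j<?n. h (ts ! j) (ss ! i) * C i j) -
      (\<Sum>i<?n. \<Sum>j<?n. \<Sum>u\<in>{ts ! j..0}. h (ts ! j) u * (D (ss ! i) u * C i j))"
    by (simp add: sum.distrib sum_subtractf)
  also have "(\<Sum>i<?n. \<Sum>j<?n. \<Sum>u\<in>{1..ss ! i}. h u (ss ! i) * (D u (ts ! j) * C i j)) =
      (\<Sum>i<?n. \<Sum>u\<in>{1..ss ! i}. h u (ss ! i) * pair_det D (ss[i := u]) ts)"
    by (intro sum.cong refl, subst sum.swap)
       (simp add: pair_det_update_row C_def sum_distrib_left)
  also have "(\<Sum>i<?n. \<Sum>j<?n. \<Sum>u\<in>{ts ! j..0}. h (ts ! j) u * (D (ss ! i) u * C i j)) =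
      (\<Sum>j<?n. \<Sum>u\<in>{ts ! j..0}. h (ts ! j) u * pair_det D ss (ts[j := u]))"
    by (subst sum.swap, intro sum.cong refl, subst sum.swap)
       (simp add: pair_det_update_col len C_def sum_distrib_left)
  also have "(\<Sum>i<?n. \<Sum>j<?n. h (ts ! j) (ss ! i) * C i j) =
      (\<Sum>i<?n. \<Sum>j<?n. (- 1) ^ (i + j) * (h (ts ! j) (ss ! i) * pair_det D (del_nth i ss) (del_nth j ts)))"
    by (intro sum.cong refl) (simp add: C_def cofactor_pair_matrix len mult.left_commute)
  finally show ?thesis
    by (simp add: wick_rhs_def len)
qed

lemma admissible_update_pos: "admissible ss ts \<Longrightarrow> u > 0 \<Longrightarrow> admissible (ss[p := u]) ts"
  using set_update_subset_insert[of ss p u] by (auto simp: admissible_def)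

lemma admissible_update_nonpos: "admissible ss ts \<Longrightarrow> u \<le> 0 \<Longrightarrow> admissible ss (ts[q := u])"
  using set_update_subset_insert[of ts q u] by (auto simp: admissible_def)

lemma admissible_del_nth:
  "admissible ss ts \<Longrightarrow> p < length ss \<Longrightarrow> q < length ts \<Longrightarrow> admissible (del_nth p ss) (del_nth q ts)"
  by (auto simp: admissible_def length_del_nth)
     (auto simp: del_nth_def dest: in_set_takeD in_set_dropD)

text \<open>
  The matrix entries are linear forms, so \<open>wick_rhs\<close> in degree \<open>n + 1\<close> only involves its argument in degree \<open>n\<close>,
  while \<open>euler\<close> is injective in positive degrees. The induction runs over all pairs of lists at once,
  since the right-hand side changes the lists.
\<close>

lemma wick_unique:
  fixes X Y :: "int list \<Rightarrow> int list \<Rightarrow> ('x, 'a :: {idom, ring_char_0}) pseries"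
  assumes X: "\<And>ss ts. admissible ss ts \<Longrightarrow> euler (X ss ts) = wick_rhs (\<lambda>i j. linear_form (c i j)) X ss ts"
    and Y: "\<And>ss ts. admissible ss ts \<Longrightarrow> euler (Y ss ts) = wick_rhs (\<lambda>i j. linear_form (c i j)) Y ss ts"
    and XY: "\<And>ss ts. admissible ss ts \<Longrightarrow> pseries_coeff (X ss ts) {#} = pseries_coeff (Y ss ts) {#}"
    and "admissible ss ts"
  shows "X ss ts = Y ss ts"
proof -
  have "eq_below_degree n (X ss ts) (Y ss ts)" if "admissible ss ts" for n ss ts
    using that
  proof (induction n arbitrary: ss ts)
    case 0
    show ?case by (simp add: eq_below_degree_def)
  next
    case (Suc n)
    have "eq_below_degree (Suc n) (euler (X ss ts)) (euler (Y ss ts))"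
      unfolding X[OF Suc.prems] Y[OF Suc.prems] wick_rhs_def
      by (intro eq_below_degree_diff eq_below_degree_add eq_below_degree_sum
            eq_below_degree_linear_form_times eq_below_degree_minus_one_power_times Suc.IH
            admissible_update_pos admissible_update_nonpos admissible_del_nth Suc.prems) auto
    then show ?case
      by (rule eq_below_degree_of_euler) (rule XY[OF Suc.prems])
  qed
  then show ?thesis
    using assms(4) by (intro pseries_eq_of_eq_below_degree)
qed

lemma bra_psi_pos:
  assumes "s > 0"
  shows "bra [] (psi s v) = 0"
proof (induction v rule: fock_induct)
  case (add S c v)
  have "maya_insert s S \<noteq> maya_of []"
    using assms occupied_vac by (metis atMost_iff insertI1 maya_insert.rep_eq not_le)
  then have "bra [] (psi s (Poly_Mapping.single S c)) = 0"
    by (simp add: psi_single bra_def lookup_single)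
  with add show ?case
    by (simp add: psi_add bra_linear)
qed (simp add: bra_def)

lemma bra_slater:
  assumes "admissible ss ts"
  shows "bra [] (slater ss ts) = (if ss = [] then 1 else 0)"
proof (cases ss)
  case Nil
  with assms show ?thesis
    by (simp add: admissible_def slater_def vac_def ket_def bra_def)
next
  case (Cons s ss')
  with assms show ?thesis
    by (simp add: admissible_def slater_def bra_psi_pos)
qed

lemma vacuum_series_slater_Nil: "vacuum_series \<alpha> \<beta> (slater [] []) = 1"
proof (rule pseries_eqI)
  fix M
  have "admissible [] []" by (simp add: admissible_def)
  then have "euler (vacuum_series \<alpha> \<beta> (slater [] [])) = 0"
    by (simp add: euler_slater wick_rhs_def)
  then have "pseries_coeff (euler (vacuum_series \<alpha> \<beta> (slater [] []))) M = 0"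
    by (simp add: zero_pseries.rep_eq)
  then show "pseries_coeff (vacuum_series \<alpha> \<beta> (slater [] [])) M = pseries_coeff 1 M"
    using bra_slater[OF \<open>admissible [] []\<close>]
    by (cases "M = {#}") (auto simp: euler.rep_eq one_pseries.rep_eq)
qed

lemma pseries_coeff_times_empty:
  "pseries_coeff (f * g) {#} = pseries_coeff f {#} * pseries_coeff g {#}"
  by (simp add: times_pseries.rep_eq)

text \<open>
  Both sides solve the same equation. The constant terms agree: \<open>\<langle>\<emptyset>|\<close> pairs to zero with a state that
  contains a particle in a positive place, so they are \<open>1\<close> for empty lists and \<open>0\<close> otherwise.
\<close>

theorem wick:
  assumes "admissible ss ts"
  shows "vacuum_series \<alpha> \<beta> (slater ss ts) =
    pair_det (\<lambda>s t. vacuum_series \<alpha> \<beta> (slater [s] [t])) ss ts"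
proof (rule wick_unique[where c = "\<lambda>i j k. current_coeff \<alpha> \<beta> (k + 1) i j / of_nat (k + 1)", OF _ _ _ assms])
  let ?D = "\<lambda>s t. vacuum_series \<alpha> \<beta> (slater [s] [t])"
  fix ss ts :: "int list"
  assume adm: "admissible ss ts"
  show "euler (vacuum_series \<alpha> \<beta> (slater ss ts)) =
      wick_rhs (\<lambda>i j. linear_form (\<lambda>k. current_coeff \<alpha> \<beta> (k + 1) i j / of_nat (k + 1)))
        (\<lambda>ss ts. vacuum_series \<alpha> \<beta> (slater ss ts)) ss ts"
    using euler_slater[OF adm, of \<alpha> \<beta>] by (simp only: H_entry_def[abs_def])
  have "euler (?D s t) = (\<Sum>u\<in>{1..s}. H_entry \<alpha> \<beta> u s * ?D u t) + H_entry \<alpha> \<beta> t s -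
      (\<Sum>u\<in>{t..0}. H_entry \<alpha> \<beta> t u * ?D s u)" if "s > 0" "t \<le> 0" for s t
    using euler_slater[of "[s]" "[t]" \<alpha> \<beta>] that
    by (simp add: admissible_def wick_rhs_def del_nth_def vacuum_series_slater_Nil)
  from euler_pair_det[OF this adm]
  show "euler (pair_det ?D ss ts) = 
      wick_rhs (\<lambda>i j. linear_form (\<lambda>k. current_coeff \<alpha> \<beta> (k + 1) i j / of_nat (k + 1)))
        (pair_det ?D) ss ts"
    by (simp only: H_entry_def[abs_def])
  show "pseries_coeff (vacuum_series \<alpha> \<beta> (slater ss ts)) {#} = pseries_coeff (pair_det ?D ss ts) {#}"
  proof (cases "ss = []")
    case True
    with adm show ?thesis
      by (simp add: bra_slater pair_det_def det_dim_zero one_pseries.rep_eq)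
  next
    case False
    let ?A = "mat (length ss) (length ss) (\<lambda>(i, j). ?D (ss ! i) (ts ! j))"
    have "pseries_coeff (?A $$ (0, j)) {#} = 0" if "j < length ss" for j
    proof -
      have "admissible [ss ! 0] [ts ! j]"
        using that adm False by (auto simp: admissible_def)
      with that False show ?thesis
        by (simp add: bra_slater)
    qed
    moreover have "pair_det ?D ss ts = (\<Sum>j<length ss. ?A $$ (0, j) * cofactor ?A 0 j)"
      unfolding pair_det_def using False by (intro laplace_expansion_row) auto
    ultimately show ?thesis
      using adm False by (simp add: bra_slater pseries_coeff_sum pseries_coeff_times_empty)
  qed
qed

section \<open>Frobenius coordinates and Maya diagrams\<close>

lemma occupied_maya_of: "occupied (maya_of l) = {int (part l i) - int i + 1 | i. 1 \<le> i}"
  by (rule maya_of.rep_eq)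

text \<open>
  If the holes are created from the lowest one upwards, no earlier hole lies above the next one, so
  creating the hole \<open>t\<close> passes exactly the \<open>-t\<close> particles in \<open>{t<..0}\<close>.
\<close>

lemma fold_psi_star_vac:
  assumes "sorted_wrt (<) ts" "\<forall>t\<in>set ts. t \<le> 0"
  shows "\<exists>S. occupied S = {..0} - set ts \<and>
    fold psi_star ts vac = Poly_Mapping.single S ((- 1) ^ (\<Sum>t\<leftarrow>ts. nat (- t)))"
  using assms
proof (induction ts rule: rev_induct)
  case Nil
  then show ?case
    by (auto simp: vac_def ket_def intro!: exI[of _ "maya_of []"] occupied_vac)
next
  case (snoc t ts)
  then obtain S where S: "occupied S = {..0} - set ts"
      "fold psi_star ts vac = Poly_Mapping.single S ((- 1) ^ (\<Sum>t\<leftarrow>ts. nat (- t)))"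
    by (auto simp: sorted_wrt_append)
  have less: "\<forall>u\<in>set ts. u < t" and t: "t \<le> 0"
    using snoc.prems by (auto simp: sorted_wrt_append)
  then have "{s \<in> occupied S. s > t} = {t<..0}"
    by (auto simp: S(1))
  then have "wedge_sign t S = (- 1) ^ nat (- t)"
    by (simp add: wedge_sign_def)
  moreover have "t \<in> occupied S"
    using less t by (auto simp: S(1))
  ultimately show ?case
    by (intro exI[of _ "maya_remove t S"])
       (auto simp: S psi_star_single maya_remove.rep_eq power_add)
qed

text \<open>
  The particles are created from the lowest one upwards, each above all occupied places, which
  produces no further sign.
\<close>

lemma slater_eq_single:
  assumes "sorted_wrt (>) ss" "sorted_wrt (<) ts" "admissible ss ts"
  shows "\<exists>S. occupied S = set ss \<union> ({..0} - set ts) \<and>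
    slater ss ts = Poly_Mapping.single S ((- 1) ^ (\<Sum>t\<leftarrow>ts. nat (- t)))"
proof -
  have "\<forall>t\<in>set ts. t \<le> 0" "\<forall>s\<in>set ss. s > 0"
    using assms(3) by (auto simp: admissible_def)
  then obtain S where S: "occupied S = {..0} - set ts"
      "fold psi_star ts vac = Poly_Mapping.single S ((- 1) ^ (\<Sum>t\<leftarrow>ts. nat (- t)))"
    using fold_psi_star_vac[OF assms(2)] by auto
  from assms(1) \<open>\<forall>s\<in>set ss. s > 0\<close> show ?thesis
    unfolding slater_def S(2)
  proof (induction ss)
    case Nil
    then show ?case using S(1) by auto
  next
    case (Cons s ss)
    then obtain T where T: "occupied T = set ss \<union> ({..0} - set ts)"
      "foldr psi ss (Poly_Mapping.single S ((- 1) ^ (\<Sum>t\<leftarrow>ts. nat (- t)))) =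
       Poly_Mapping.single T ((- 1) ^ (\<Sum>t\<leftarrow>ts. nat (- t)))"
      by auto
    have above: "{u \<in> occupied T. u > s} = {}" and "s \<notin> occupied T"
      using Cons.prems by (force simp: T(1))+
    moreover have "wedge_sign s T = 1"
      unfolding wedge_sign_def above by simp
    ultimately show ?case
      by (intro exI[of _ "maya_insert s T"]) (auto simp: T psi_single maya_insert.rep_eq)
  qed
qed

lemma vacuum_series_slater_eq_double_schur:
  assumes "sorted_wrt (>) ss" "sorted_wrt (<) ts" "admissible ss ts"
    and "occupied (maya_of l) = set ss \<union> ({..0} - set ts)"
  shows "vacuum_series \<alpha> \<beta> (slater ss ts) = (- 1) ^ (\<Sum>t\<leftarrow>ts. nat (- t)) * double_schur \<alpha> \<beta> l"
proof -
  obtain S where S: "occupied S = set ss \<union> ({..0} - set ts)"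
    "slater ss ts = Poly_Mapping.single S ((- 1) ^ (\<Sum>t\<leftarrow>ts. nat (- t)))"
    using slater_eq_single[OF assms(1-3)] by blast
  have "S = maya_of l"
    by (rule maya_eqI) (simp add: S assms(4))
  then have "slater ss ts = fscale ((- 1) ^ (\<Sum>t\<leftarrow>ts. nat (- t))) (ket l)"
    by (simp add: S ket_def)
  then show ?thesis
    by (simp add: vacuum_series_fscale_sign double_schur_eq_vacuum_series)
qed

lemma occupied_hook: "occupied (maya_of (hook a b)) = {int a + 1} \<union> ({..0} - {- int b})"
proof -
  have part: "part (hook a b) i = (if i = 1 then a + 1 else if i \<le> b + 1 then 1 else 0)" if "1 \<le> i" for i
    using that by (auto simp: part_def hook_def nth_Cons')
  have "x \<in> {int (part (hook a b) i) - int i + 1 | i. 1 \<le> i}" if x: "x \<in> {int a + 1} \<union> ({..0} - {- int b})" for x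
  proof -
    consider "x = int a + 1" | "x < - int b" | "- int b < x" "x \<le> 0"
      using x by fastforce
    then show ?thesis
    proof cases
      case 1
      then show ?thesis by (auto simp: part intro!: exI[of _ 1])
    next
      case 2
      then show ?thesis by (auto simp: part intro!: exI[of _ "nat (1 - x)"])
    next
      case 3
      then show ?thesis by (auto simp: part intro!: exI[of _ "nat (2 - x)"])
    qed
  qed
  moreover have "x \<in> {int a + 1} \<union> ({..0} - {- int b})"
    if "x \<in> {int (part (hook a b) i) - int i + 1 | i. 1 \<le> i}" for x
  proof -
    from that obtain i where "1 \<le> i" "x = int (part (hook a b) i) - int i + 1"
      by blast
    then show ?thesis
      by (cases "i = 1"; cases "i \<le> b + 1") (simp_all add: part)
  qed
  ultimately show ?thesis
    unfolding occupied_maya_of by blast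
qed

lemma vacuum_series_slater_hook:
  "vacuum_series \<alpha> \<beta> (slater [int a + 1] [- int b]) = (- 1) ^ b * double_schur \<alpha> \<beta> (hook a b)"
  using vacuum_series_slater_eq_double_schur[of "[int a + 1]" "[- int b]" "hook a b"]
  by (simp add: admissible_def occupied_hook)

lemma part_antimono:
  assumes "is_partition l" "1 \<le> i" "i \<le> j"
  shows "part l j \<le> part l i"
  using assms by (cases "i = j") (auto simp: is_partition_def part_def sorted_wrt_iff_nth_less)

text \<open>
  The conjugate partition and the rank are defined as cardinalities; this turns them into upper bounds,
  so that they are characterised by inequalities.
\<close>

lemma down_closed_nat_set:
  assumes "finite A" "0 \<notin> A" "\<And>i j. j \<in> A \<Longrightarrow> 1 \<le> i \<Longrightarrow> i \<le> j \<Longrightarrow> i \<in> A"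
  shows "A = {1..card A}"
proof (cases "A = {}")
  case False
  then have "Max A \<in> A"
    using assms(1) by simp
  then have "A = {1..Max A}"
    using assms(1,2) assms(3)[of "Max A"] by (auto simp: Suc_le_eq intro: gr0I)
  then show ?thesis
    by (metis card_atLeastAtMost diff_Suc_1)
qed simp

lemma finite_part_ge: "1 \<le> j \<Longrightarrow> finite {r. 1 \<le> r \<and> j \<le> part l r}"
  by (rule finite_subset[of _ "{1..length l}"]) (auto simp: part_def split: if_splits)

lemma le_part_iff:
  assumes "is_partition l" "1 \<le> i" "1 \<le> j"
  shows "j \<le> part l i \<longleftrightarrow> i \<le> conj_part l j"
proof -
  have "{r. 1 \<le> r \<and> j \<le> part l r} = {1..conj_part l j}"
    unfolding conj_part_def
    using assms part_antimono[OF assms(1)] finite_part_ge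
    by (intro down_closed_nat_set) (auto intro: order_trans)
  then have "i \<in> {r. 1 \<le> r \<and> j \<le> part l r} \<longleftrightarrow> i \<in> {1..conj_part l j}"
    by (rule arg_cong)
  then show ?thesis
    using assms(2) by simp
qed

lemma le_part_diag_iff:
  assumes "is_partition l" "1 \<le> i"
  shows "i \<le> part l i \<longleftrightarrow> i \<le> frob_rank l"
proof -
  have "{i. 1 \<le> i \<and> i \<le> part l i} = {1..frob_rank l}"
    unfolding frob_rank_def
  proof (rule down_closed_nat_set)
    show "finite {i. 1 \<le> i \<and> i \<le> part l i}"
      by (rule finite_subset[OF _ finite_part_ge[of 1 l]]) auto
    show "i \<in> {i. 1 \<le> i \<and> i \<le> part l i}"
      if "j \<in> {i. 1 \<le> i \<and> i \<le> part l i}" "1 \<le> i" "i \<le> j" for i j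
      using that part_antimono[OF assms(1), of i j] by auto
  qed auto
  then have "i \<in> {i. 1 \<le> i \<and> i \<le> part l i} \<longleftrightarrow> i \<in> {1..frob_rank l}"
    by (rule arg_cong)
  then show ?thesis
    using assms(2) by simp
qed

lemma int_frob_a: "is_partition l \<Longrightarrow> 1 \<le> i \<Longrightarrow> i \<le> frob_rank l \<Longrightarrow> int (frob_a l i) = int (part l i) - int i"
  using le_part_diag_iff[of l i] by (simp add: frob_a_def of_nat_diff)

lemma int_frob_b: "is_partition l \<Longrightarrow> 1 \<le> i \<Longrightarrow> i \<le> frob_rank l \<Longrightarrow> int (frob_b l i) = int (conj_part l i) - int i"
  using le_part_diag_iff[of l i] le_part_iff[of l i i] by (simp add: frob_b_def of_nat_diff)

text \<open>
  The numbers \<open>\<lambda>\<^sub>i - i + 1\<close> and \<open>j - \<lambda>'\<^sub>j\<close> for \<open>i, j \<ge> 1\<close> are disjoint: depending on whether the box \<open>(i, j)\<close> belongs to the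
  diagram, \<open>\<lambda>\<^sub>i + \<lambda>'\<^sub>j\<close> is at least \<open>i + j\<close> or at most \<open>i + j - 2\<close>, and never \<open>i + j - 1\<close>. They also fill up the integers:
  for a nonpositive place \<open>x\<close>, the first \<open>i\<close> with \<open>\<lambda>\<^sub>i - i + 1 \<le> x\<close> either gives equality or determines
  the column \<open>j = x + i - 1\<close> of height \<open>i - 1\<close>, so that \<open>x = j - \<lambda>'\<^sub>j\<close>. The part in positive places
  comes from \<open>i \<le> m\<close>, and the nonpositive holes come from \<open>j \<le> m\<close>.
\<close>

lemma occupied_maya_of_frobenius:
  assumes l: "is_partition l"
  shows "occupied (maya_of l) = (\<lambda>i. int (frob_a l i) + 1) ` {1..frob_rank l} \<union>
    ({..0} - (\<lambda>j. - int (frob_b l j)) ` {1..frob_rank l})"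
proof (intro equalityI subsetI)
  fix x assume "x \<in> occupied (maya_of l)"
  then obtain i where i: "1 \<le> i" and x: "x = int (part l i) - int i + 1"
    by (auto simp: occupied_maya_of)
  show "x \<in> (\<lambda>i. int (frob_a l i) + 1) ` {1..frob_rank l} \<union>
    ({..0} - (\<lambda>j. - int (frob_b l j)) ` {1..frob_rank l})"
  proof (cases "i \<le> frob_rank l")
    case True
    then show ?thesis
      using i int_frob_a[OF l i] by (intro UnI1 image_eqI[of _ _ i]) (auto simp: x)
  next
    case False
    then have "x \<le> 0"
      using le_part_diag_iff[OF l i] by (simp add: x)
    moreover have "x \<noteq> - int (frob_b l j)" if j: "1 \<le> j" "j \<le> frob_rank l" for j
      using le_part_iff[OF l i j(1)] int_frob_b[OF l j] by (cases "j \<le> part l i") (auto simp: x)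
    ultimately have "x \<in> {..0} - (\<lambda>j. - int (frob_b l j)) ` {1..frob_rank l}"
      unfolding Diff_iff image_iff by (metis atLeastAtMost_iff atMost_iff)
    then show ?thesis ..
  qed
next
  fix x assume "x \<in> (\<lambda>i. int (frob_a l i) + 1) ` {1..frob_rank l} \<union>
    ({..0} - (\<lambda>j. - int (frob_b l j)) ` {1..frob_rank l})"
  then show "x \<in> occupied (maya_of l)"
  proof
    assume "x \<in> (\<lambda>i. int (frob_a l i) + 1) ` {1..frob_rank l}"
    then show ?thesis
      using int_frob_a[OF l] by (force simp: occupied_maya_of)
  next
    assume "x \<in> {..0} - (\<lambda>j. - int (frob_b l j)) ` {1..frob_rank l}"
    then have x: "x \<le> 0" and not: "\<And>j. 1 \<le> j \<Longrightarrow> j \<le> frob_rank l \<Longrightarrow> x \<noteq> - int (frob_b l j)"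
      by auto
    define P where "P i \<longleftrightarrow> 1 \<le> i \<and> int (part l i) - int i + 1 \<le> x" for i
    have "P (nat (int (part l 1) + 1 - x))"
      using x part_antimono[OF l, of 1 "nat (int (part l 1) + 1 - x)"] by (auto simp: P_def)
    then have P: "P (Least P)" and least: "\<And>i. i < Least P \<Longrightarrow> \<not> P i"
      by (auto intro: LeastI dest: not_less_Least)
    define i where "i = Least P"
    have "int (part l i) - int i + 1 = x"
    proof (rule ccontr)
      assume "int (part l i) - int i + 1 \<noteq> x"
      with P have less: "int (part l i) - int i + 1 < x" and "1 \<le> i"
        by (auto simp: P_def i_def)
      with x have "i \<noteq> 1" by auto
      with \<open>1 \<le> i\<close> obtain i' where i': "i = Suc i'" "1 \<le> i'"
        by (cases i) auto
      then have above: "x < int (part l i') - int i' + 1"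
        using least[of i'] by (auto simp: P_def i_def)
      \<comment> \<open>The column of height i' that ends between the rows i' and i.\<close>
      define j where "j = nat (x + int i')"
      have j: "int j = x + int i'" "1 \<le> j"
        using less i' by (auto simp: j_def)
      have "j \<le> part l i'" "\<not> j \<le> part l i"
        using above less j i' by auto
      then have conj: "conj_part l j = i'"
        using le_part_iff[OF l _ j(2)] i' by fastforce
      have "j \<le> i'"
        using j x by simp
      then have "j \<le> part l j"
        using \<open>j \<le> part l i'\<close> part_antimono[OF l j(2)] by (meson order_trans)
      then have "j \<le> frob_rank l"
        using le_part_diag_iff[OF l j(2)] by simp
      then show False
        using not[OF j(2)] int_frob_b[OF l j(2)] conj j(1) by simp
    qed
    moreover have "1 \<le> i"
      using P by (simp add: P_def i_def)
    ultimately show ?thesis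
      by (auto simp: occupied_maya_of)
  qed
qed

lemma conj_part_antimono:
  assumes "is_partition l" "1 \<le> i" "i \<le> j"
  shows "conj_part l j \<le> conj_part l i"
  unfolding conj_part_def using assms by (intro card_mono finite_part_ge) auto

lemma frob_a_less:
  assumes "is_partition l" "1 \<le> i" "i < j" "j \<le> frob_rank l"
  shows "frob_a l j < frob_a l i"
  using int_frob_a[OF assms(1), of i] int_frob_a[OF assms(1), of j] part_antimono[OF assms(1), of i j] assms
  by simp

lemma frob_b_less:
  assumes "is_partition l" "1 \<le> i" "i < j" "j \<le> frob_rank l"
  shows "frob_b l j < frob_b l i"
  using int_frob_b[OF assms(1), of i] int_frob_b[OF assms(1), of j] conj_part_antimono[OF assms(1), of i j] assms
  by simp

theorem theorem5p12:
  fixes \<alpha> \<beta> :: "int \<Rightarrow> complex" and l :: "nat list"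
  assumes "is_partition l"
  shows "double_schur \<alpha> \<beta> l =
    det (mat (frob_rank l) (frob_rank l)
      (\<lambda>(i, j). double_schur \<alpha> \<beta> (hook (frob_a l (i + 1)) (frob_b l (j + 1)))))"
proof -
  define m where "m = frob_rank l"
  define ss where "ss = map (\<lambda>i. int (frob_a l (i + 1)) + 1) [0..<m]"
  define ts where "ts = map (\<lambda>j. - int (frob_b l (j + 1))) [0..<m]"
  define eps :: "(nat, complex) pseries" where "eps = (- 1) ^ (\<Sum>j<m. frob_b l (j + 1))"
  define X where "X = (\<lambda>i j. double_schur \<alpha> \<beta> (hook (frob_a l (i + 1)) (frob_b l (j + 1))))"
  have sorted: "sorted_wrt (>) ss" "sorted_wrt (<) ts"
    unfolding sorted_wrt_iff_nth_less
  proof safe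
    fix i j :: nat assume "i < j"
    show "ss ! j < ss ! i" if "j < length ss"
      using that \<open>i < j\<close> frob_a_less[OF assms, of "i + 1" "j + 1"] by (simp add: ss_def m_def)
    show "ts ! i < ts ! j" if "j < length ts"
      using that \<open>i < j\<close> frob_b_less[OF assms, of "i + 1" "j + 1"] by (simp add: ts_def m_def)
  qed
  have adm: "admissible ss ts"
    by (auto simp: admissible_def ss_def ts_def)
  have "f ` {1..m} = (\<lambda>i. f (i + 1)) ` {0..<m}" for f :: "nat \<Rightarrow> int"
    using image_Suc_atLeastLessThan[of 0 m] by (simp add: image_image atLeastLessThanSuc_atLeastAtMost flip: image_image[of f Suc])
  then have "set ss = (\<lambda>i. int (frob_a l i) + 1) ` {1..m}" "set ts = (\<lambda>j. - int (frob_b l j)) ` {1..m}"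
    by (simp_all add: ss_def ts_def)
  then have occ: "occupied (maya_of l) = set ss \<union> ({..0} - set ts)"
    using occupied_maya_of_frobenius[OF assms] by (simp add: m_def)
  have "(\<Sum>t\<leftarrow>ts. nat (- t)) = (\<Sum>j<m. frob_b l (j + 1))"
    by (simp add: ts_def o_def interv_sum_list_conv_sum_set_nat atLeast0LessThan)
  then have "eps * double_schur \<alpha> \<beta> l = vacuum_series \<alpha> \<beta> (slater ss ts)"
    using vacuum_series_slater_eq_double_schur[OF sorted adm occ] by (simp add: eps_def)
  also have "\<dots> = pair_det (\<lambda>s t. vacuum_series \<alpha> \<beta> (slater [s] [t])) ss ts"
    by (rule wick[OF adm])
  \<comment> \<open>The sign of a hook depends only on its leg, hence only on the column of the matrix.\<close>
  also have "\<dots> = det (mat m m (\<lambda>(i, j). (- 1) ^ frob_b l (j + 1) * X i j))"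
    unfolding pair_det_def
    by (rule arg_cong[of _ _ det], rule eq_matI)
       (auto simp: ss_def ts_def X_def vacuum_series_slater_hook)
  also have "\<dots> = eps * det (mat m m (\<lambda>(i, j). X i j))"
    by (simp add: det_scale_columns eps_def power_sum)
  finally have "eps * (eps * double_schur \<alpha> \<beta> l) = eps * (eps * det (mat m m (\<lambda>(i, j). X i j)))"
    by simp
  moreover have "eps * eps = 1"
    by (simp add: eps_def flip: power_add)
  ultimately show ?thesis
    by (simp add: m_def X_def flip: mult.assoc)
qed

end
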